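(* Let $0<p\leq 1$. The operators $W_*$ and $g$ are bounded from $\mathcal{H}^p(\mathbb{Z})$ into $\ell^p(\mathbb{Z})$; that is, there exists $C>0$ such that $\|W_*(f)\|_p\leq C\|f\|_{\mathcal{H}^p(\mathbb{Z})}$ and $\|g(f)\|_p\leq C\|f\|_{\mathcal{H}^p(\mathbb{Z})}$ for every $f\in\mathcal{H}^p(\mathbb{Z})$.
   Context: $\mathbb{N}=\{0,1,2,\dots\}$. $\mathbb{Z}$ carries the distance $|n-m|$ and the counting measure $\mu$; $B_{\mathbb{Z}}(n_0,r_0)$ denotes the ball in $\mathbb{Z}$ with center $n_0$ and radius $r_0$. For $0<p\leq\infty$, $\ell^p(\mathbb{Z})$ is the usual Lebesgue (sequence) space of complex sequences on $\mathbb{Z}$ with respect to $\mu$, with (quasi)norm $\|\cdot\|_p$. Heat semigroup of the discrete Laplacian $(\Delta_d f)(n)=-f(n+1)+2f(n)-f(n-1)$: let $G(n,t)=e^{-2t}I_n(2t)$, $n\in\mathbb{Z}$, $t>0$, where $I_n$ is the modified Bessel function of the first kind of order $n$; equivalently $G(n,t)=\frac1\pi\int_0^\pi e^{-2t(1-\cos\theta)}\cos(n\theta)\,d\theta$. For $f\in\ell^r(\mathbb{Z})$, $1\leq r\leq\infty$, put $W_t(f)(n)=\sum_{m\in\mathbb{Z}}G(n-m,t)f(m)$. The maximal operator is $W_*(f)(n)=\sup_{t>0}|W_t(f)(n)|$ and the Littlewood-Paley function is $g(f)(n)=\left(\int_0^\infty|t\,\partial_tW_t(f)(n)|^2\frac{dt}{t}\right)^{1/2}$,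 $n\in\mathbb{Z}$. Discrete Hardy space $\mathcal{H}^p(\mathbb{Z})$, $0<p\leq1$. A complex sequence $\mathfrak{b}$ is an $(H,p,\infty)$-atom when there exist $n_0\in\mathbb{Z}$ and $r_0\geq1$ such that: (i) the support of $\mathfrak{b}$ is contained in $B_{\mathbb{Z}}(n_0,r_0)$; (ii) $\|\mathfrak{b}\|_\infty\leq\mu(B_{\mathbb{Z}}(n_0,r_0))^{-1/p}$; (iii) $\sum_{n\in\mathbb{Z}}n^\alpha\mathfrak{b}(n)=0$ for every $\alpha\in\mathbb{N}$ with $\alpha\leq 1/p-1$. For $\alpha>0$, $\mathcal{L}_\alpha$ is the space of complex sequences $\mathfrak{a}$ with $\|\mathfrak{a}\|_{\mathcal{L}_\alpha}=\sup_{n\neq m}|\mathfrak{a}(n)-\mathfrak{a}(m)|/|n-m|^\alpha<\infty$, and $(\mathcal{L}_\alpha)'$ is its dual. For $0<p<1$ every $(H,p,\infty)$-atom $\mathfrak{b}$ defines an element of $(\mathcal{L}_{1/p-1})'$ by $\mathfrak{a}\mapsto\sum_{n\in\mathbb{Z}}\mathfrak{a}(n)\mathfrak{b}(n)$. For $0<p<1$, $\mathcal{H}^p(\mathbb{Z})$ consists of those $h\in(\mathcal{L}_{1/p-1})'$ for which there are $(H,p,\infty)$-atoms $\mathfrak{b}_j$ and $\lambda_j>0$, $j\in\mathbb{N}$, with $\sum_j\lambda_j^p<\infty$ and $h=\sum_j\lambda_j\mathfrak{b}_j$ in $(\mathcal{L}_{1/p-1})'$. The series then also converges in $\ell^p(\mathbb{Z})$,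 and $h$ is identified with its sum, the sequence $h(n)=\sum_j\lambda_j\mathfrak{b}_j(n)$; so $\mathcal{H}^p(\mathbb{Z})\subset\ell^p(\mathbb{Z})$. For $p=1$, $\mathcal{H}^1(\mathbb{Z})$ consists of those $h\in\ell^1(\mathbb{Z})$ with $h=\sum_j\lambda_j\mathfrak{b}_j$ in $\ell^1(\mathbb{Z})$, $\mathfrak{b}_j$ being $(H,1,\infty)$-atoms, $\lambda_j>0$, $\sum_j\lambda_j<\infty$. In both cases $\|h\|_{\mathcal{H}^p(\mathbb{Z})}=\inf\big(\sum_j\lambda_j^p\big)^{1/p}$, the infimum being over all such representations of $h$ (with $\lambda_j\geq0$). *)

theory Defs
  imports "HOL-Analysis.Analysis"
begin

section \<open>Quasinorms of sequences on the integers\<close>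

text \<open>Real powers on \<open>[0, \<infinity>]\<close>; only exponents \<open>q > 0\<close> are used, so \<open>\<infinity>\<close> is sent to \<open>\<infinity>\<close>.\<close>

definition enn_powr :: "ennreal \<Rightarrow> real \<Rightarrow> ennreal" where
  "enn_powr x q = (if x = \<infinity> then \<infinity> else ennreal (enn2real x powr q))"

text \<open>The quasinorm takes \<open>[0, \<infinity>]\<close>-valued sequences, so that it applies to \<open>\<lambda>n. norm (f n)\<close> and
  also to maximal and square functions, which might a priori be infinite at some points.\<close>

definition lp_norm :: "real \<Rightarrow> (int \<Rightarrow> ennreal) \<Rightarrow> ennreal" where
  "lp_norm p F = enn_powr (\<integral>\<^sup>+ n. enn_powr (F n) p \<partial>count_space UNIV) (1 / p)"

definition lp_space :: "real \<Rightarrow> (int \<Rightarrow> complex) set" where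
  "lp_space p = {f. lp_norm p (\<lambda>n. ennreal (norm (f n))) < \<infinity>}"


section \<open>The heat semigroup of the discrete Laplacian\<close>

text \<open>The modified Bessel function of the first kind of integer order, by its power series
  and \<open>I\<^sub>-\<^sub>n = I\<^sub>n\<close>.\<close>

definition bessel_I :: "int \<Rightarrow> real \<Rightarrow> real" where
  "bessel_I n x =
     (\<Sum>k. (x / 2) ^ (2 * k + nat \<bar>n\<bar>) / (fact k * fact (k + nat \<bar>n\<bar>)))"

definition heat_kernel :: "int \<Rightarrow> real \<Rightarrow> real" where
  "heat_kernel n t = exp (- 2 * t) * bessel_I n (2 * t)"

definition heat_op :: "real \<Rightarrow> (int \<Rightarrow> complex) \<Rightarrow> int \<Rightarrow> complex" where
  "heat_op t f n = (\<Sum>\<^sub>\<infinity>m. complex_of_real (heat_kernel (n - m) t) * f m)"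

definition heat_maximal :: "(int \<Rightarrow> complex) \<Rightarrow> int \<Rightarrow> ennreal" where
  "heat_maximal f n = (SUP t\<in>{0<..}. ennreal (norm (heat_op t f n)))"

definition heat_square :: "(int \<Rightarrow> complex) \<Rightarrow> int \<Rightarrow> ennreal" where
  "heat_square f n =
     enn_powr
       (\<integral>\<^sup>+ t\<in>{0<..}.
          ennreal ((norm (t *\<^sub>R vector_derivative (\<lambda>s. heat_op s f n) (at t)))\<^sup>2 / t) \<partial>lborel)
       (1 / 2)"


section \<open>Atoms\<close>

text \<open>The ball is taken to be open. With closed balls the same sequences would be atoms: the only
  additional sets of the form \<open>ball_Z n0 r0\<close> with \<open>r0 \<ge> 1\<close> are singletons, and an atom supported
  in a singleton is \<open>0\<close> by the moment condition.\<close>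

definition ball_Z :: "int \<Rightarrow> real \<Rightarrow> int set" where
  "ball_Z n0 r0 = {n. real_of_int \<bar>n - n0\<bar> < r0}"

definition hardy_atom :: "real \<Rightarrow> (int \<Rightarrow> complex) \<Rightarrow> bool" where
  "hardy_atom p b \<longleftrightarrow>
     (\<exists>n0 :: int. \<exists>r0 :: real. r0 \<ge> 1 \<and>
        {n. b n \<noteq> 0} \<subseteq> ball_Z n0 r0 \<and>
        (SUP n. norm (b n)) \<le> real (card (ball_Z n0 r0)) powr (- 1 / p) \<and>
        (\<forall>k :: nat. real k \<le> 1 / p - 1 \<longrightarrow> (\<Sum>\<^sub>\<infinity>n. of_int n ^ k * b n) = 0))"


section \<open>Lipschitz spaces and their duals\<close>

definition lip_norm :: "real \<Rightarrow> (int \<Rightarrow> complex) \<Rightarrow> ennreal" where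
  "lip_norm \<alpha> a =
     (SUP (n, m)\<in>{(n, m). n \<noteq> m}. ennreal (norm (a n - a m) / real_of_int \<bar>n - m\<bar> powr \<alpha>))"

definition lip_space :: "real \<Rightarrow> (int \<Rightarrow> complex) set" where
  "lip_space \<alpha> = {a. lip_norm \<alpha> a < \<infinity>}"

text \<open>Functionals on \<^const>\<open>lip_space\<close> are total functions of which only the values on that
  space matter.\<close>

definition lip_dual_norm :: "real \<Rightarrow> ((int \<Rightarrow> complex) \<Rightarrow> complex) \<Rightarrow> ennreal" where
  "lip_dual_norm \<alpha> h = (SUP a\<in>{a. lip_norm \<alpha> a \<le> 1}. ennreal (norm (h a)))"

definition lip_dual :: "real \<Rightarrow> ((int \<Rightarrow> complex) \<Rightarrow> complex) set" where
  "lip_dual \<alpha> =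
     {h. (\<forall>a\<in>lip_space \<alpha>. \<forall>a'\<in>lip_space \<alpha>. h (\<lambda>n. a n + a' n) = h a + h a') \<and>
         (\<forall>c. \<forall>a\<in>lip_space \<alpha>. h (\<lambda>n. c * a n) = c * h a) \<and>
         lip_dual_norm \<alpha> h < \<infinity>}"

definition seq_functional :: "(int \<Rightarrow> complex) \<Rightarrow> (int \<Rightarrow> complex) \<Rightarrow> complex" where
  "seq_functional b a = (\<Sum>\<^sub>\<infinity>n. a n * b n)"


section \<open>Hardy spaces\<close>

definition atomic_data :: "real \<Rightarrow> (nat \<Rightarrow> real) \<Rightarrow> (nat \<Rightarrow> int \<Rightarrow> complex) \<Rightarrow> bool" where
  "atomic_data p l b \<longleftrightarrow>
     (\<forall>j. hardy_atom p (b j)) \<and> (\<forall>j. l j \<ge> 0) \<and> summable (\<lambda>j. l j powr p)"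

text \<open>For \<open>p < 1\<close> the elements of the Hardy space are the functionals \<open>h\<close>; the sequence \<open>f\<close> below is
  the one with which \<open>h\<close> is identified. It determines \<open>h\<close> on \<^term>\<open>lip_space (1 / p - 1)\<close>
  and does not depend on the representation, since \<open>f n\<close> is the value of \<open>h\<close> at the indicator
  of \<open>{n}\<close>.\<close>

definition atomic_rep ::
  "real \<Rightarrow> (int \<Rightarrow> complex) \<Rightarrow> (nat \<Rightarrow> real) \<Rightarrow> (nat \<Rightarrow> int \<Rightarrow> complex) \<Rightarrow> bool" where
  "atomic_rep p f l b \<longleftrightarrow> atomic_data p l b \<and>
     (if p < 1 then
        (\<exists>h\<in>lip_dual (1 / p - 1).
           (\<lambda>N. lip_dual_norm (1 / p - 1)
                  (\<lambda>a. h a - (\<Sum>j<N. complex_of_real (l j) * seq_functional (b j) a)))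
             \<longlonglongrightarrow> 0) \<and>
        (\<forall>n. (\<lambda>j. complex_of_real (l j) * b j n) sums f n)
      else
        f \<in> lp_space 1 \<and>
        (\<lambda>N. lp_norm 1
               (\<lambda>n. ennreal (norm (f n - (\<Sum>j<N. complex_of_real (l j) * b j n)))))
          \<longlonglongrightarrow> 0)"

definition hardy_space :: "real \<Rightarrow> (int \<Rightarrow> complex) set" where
  "hardy_space p = {f. \<exists>l b. (\<forall>j. l j > 0) \<and> atomic_rep p f l b}"

definition hardy_norm :: "real \<Rightarrow> (int \<Rightarrow> complex) \<Rightarrow> real" where
  "hardy_norm p f = Inf {(\<Sum>j. l j powr p) powr (1 / p) | l b. atomic_rep p f l b}"

end

theory Submission
  imports Defs
begin

text \<open>
  The proof is the classical one by atomic decomposition. Both operators are sublinear, also for countable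
  sums, and \<open>x \<mapsto> x powr p\<close> is subadditive for \<open>p \<le> 1\<close>. So for \<open>f = \<Sum>j. l j * b j\<close> the \<open>p\<close>-th powers of
  the quasinorms are at most \<open>\<Sum>j. l j powr p\<close> times a bound that is uniform over all atoms
  (\<open>heat_maximal_atom_bound\<close>, \<open>heat_square_atom_bound\<close>), and one takes the infimum over all
  decompositions. Interchanging the heat flow and its time derivative with the sum is harmless, because the
  series converges absolutely in \<open>\<ell>\<^sup>1\<close> (\<open>heat_op_atomic_sums\<close>,
  \<open>vector_derivative_heat_op_atomic_sums\<close>); the square function is countably subadditive by Minkowski's
  inequality in \<open>L\<^sup>2\<close>.

  Let \<open>b\<close> be an atom on a ball with centre \<open>n0\<close> and radius \<open>R\<close>. Up to twice that radius a bound in the mean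
  square suffices. For the maximal function it holds because the heat kernel has uniformly bounded
  \<open>\<ell>\<^sup>1\<close> norm (\<open>heat_kernel_l1_bounded\<close>). For the square function it follows from Bessel's inequality on the
  Fourier side, where the integral over \<open>t\<close> becomes explicit (\<open>heat_contour_square_l2\<close>).

  Away from the ball the vanishing moments of \<open>b\<close> must produce decay, and this is the heart of the matter.
  Instead of estimating finite differences of the kernel, the atom is put inside the integral
  representation of the kernel, \<open>heat_kernel_contour_integral\<close>. This is an integral of
  \<open>exp (t * heat_symbol z) * exp (- n * z)\<close> over the segment \<open>Re z = \<rho>\<close>, \<open>\<bar>Im z\<bar> \<le> \<pi>\<close>, with \<open>\<rho>\<close> at our disposal.
  Taking \<open>\<bar>\<rho>\<bar> = \<eta>\<close> with \<open>\<eta> = 1 / sqrt (1 + t)\<close> keeps the first factor under control and makes the second one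
  decay like \<open>exp (- \<eta> * \<bar>n\<bar>)\<close>. The sum of \<open>b m * exp ((m - n0) * z)\<close> over \<open>m\<close> vanishes at \<open>z = 0\<close> to the order
  \<open>K\<close> given by the number of moments, which yields the factor \<open>(R * \<eta>) ^ K\<close> in \<open>heat_contour_far_bound\<close>.
  Optimising over \<open>t\<close>, or integrating over \<open>t\<close>, turns this into a bound by a multiple of
  \<open>R powr (K + 1 - 1 / p) / \<bar>n - n0\<bar> ^ (K + 1)\<close>. Its \<open>p\<close>-th powers have a sum independent of \<open>R\<close>, as
  \<open>K = \<lfloor>1 / p\<rfloor>\<close> gives \<open>p * (K + 1) > 1\<close>.
\<close>

section \<open>The heat kernel as a contour integral\<close>

text \<open>The generator of the heat semigroup multiplies \<open>\<lambda>n. exp (- n * z)\<close> by this number, so the semigroup multiplies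
  it by \<open>exp (t * heat_symbol z)\<close>. At \<open>z = \<i> * \<theta>\<close> it is \<open>- 2 * (1 - cos \<theta>)\<close>.\<close>

definition heat_symbol :: "complex \<Rightarrow> complex" where
  "heat_symbol z = exp z + exp (- z) - 2"

lemma continuous_on_heat_symbol [continuous_intros]:
  assumes "continuous_on S f"
  shows "continuous_on S (\<lambda>x. heat_symbol (f x))"
  unfolding heat_symbol_def by (intro continuous_intros assms)

lemma continuous_on_Complex [continuous_intros]:
  assumes "continuous_on S f" "continuous_on S g"
  shows "continuous_on S (\<lambda>x. Complex (f x) (g x))"
  unfolding Complex_eq by (intro continuous_intros assms)

lemma norm_exp_minus_Taylor_le:
  "norm (exp z - (\<Sum>k<K. z ^ k / fact k)) \<le> exp \<bar>Re z\<bar> * norm z ^ K"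
proof (cases K)
  case 0
  then show ?thesis by simp
next
  case (Suc n)
  have "norm (exp z - (\<Sum>k\<le>n. z ^ k / fact k)) \<le> exp \<bar>Re z\<bar> * norm z ^ Suc n / fact n"
    by (rule Taylor_exp)
  also have "\<dots> \<le> exp \<bar>Re z\<bar> * norm z ^ Suc n / 1"
    by (intro divide_left_mono) auto
  finally show ?thesis by (simp add: Suc lessThan_Suc_atMost)
qed

text \<open>The Taylor polynomials of order one of \<open>exp z\<close> and \<open>exp (- z)\<close> add up to \<open>2\<close>, so only the two
  quadratic remainders are left.\<close>

lemma norm_heat_symbol_le: "norm (heat_symbol z) \<le> 2 * exp \<bar>Re z\<bar> * norm z ^ 2"
proof -
  have "heat_symbol z = (exp z - (\<Sum>k<2. z ^ k / fact k)) + (exp (-z) - (\<Sum>k<2. (-z) ^ k / fact k))"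
    by (simp add: heat_symbol_def numeral_2_eq_2)
  also have "norm \<dots> \<le> exp \<bar>Re z\<bar> * norm z ^ 2 + exp \<bar>Re (-z)\<bar> * norm (-z) ^ 2"
    by (intro order_trans[OF norm_triangle_ineq] add_mono norm_exp_minus_Taylor_le)
  finally show ?thesis by simp
qed

lemma Re_heat_symbol: "Re (heat_symbol (Complex \<rho> \<theta>)) = 2 * (cosh \<rho> * cos \<theta> - 1)"
  by (simp add: heat_symbol_def Re_exp cosh_def algebra_simps)

text \<open>Moving the contour from \<open>Re z = 0\<close> to \<open>Re z = \<rho>\<close> costs only the first term, which is harmless
  as long as \<open>t * \<rho>\<^sup>2\<close> stays bounded; the Gaussian gain in \<open>\<theta>\<close> is kept in full. This uses
  \<open>cosh \<rho> \<ge> 1\<close>.\<close>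

lemma Re_heat_symbol_le:
  "Re (heat_symbol (Complex \<rho> \<theta>)) \<le> 2 * exp \<bar>\<rho>\<bar> * \<rho>\<^sup>2 - 2 * (1 - cos \<theta>)"
proof -
  have "2 * (cosh \<rho> - 1) = Re (heat_symbol (Complex \<rho> 0))"
    by (simp add: Re_heat_symbol)
  also have "\<dots> \<le> norm (heat_symbol (Complex \<rho> 0))" by (rule complex_Re_le_cmod)
  also have "\<dots> \<le> 2 * exp \<bar>\<rho>\<bar> * \<rho>\<^sup>2"
    using norm_heat_symbol_le[of "Complex \<rho> 0"] by (simp add: complex_norm)
  finally have *: "2 * (cosh \<rho> - 1) \<le> 2 * exp \<bar>\<rho>\<bar> * \<rho>\<^sup>2" .
  have "(cosh \<rho> - 1) * (1 - cos \<theta>) \<ge> 0"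
    using cosh_real_ge_1[of \<rho>] cos_le_one[of \<theta>] by (intro mult_nonneg_nonneg) auto
  with * show ?thesis unfolding Re_heat_symbol by (simp add: algebra_simps)
qed

lemma integral_exp_int:
  "integral {-pi..pi} (\<lambda>\<theta>. exp (of_int m * Complex \<rho> \<theta>)) = (if m = 0 then 2 * pi else 0)"
proof (cases "m = 0")
  case False
  define F where "F = (\<lambda>\<theta>. exp (of_int m * Complex \<rho> \<theta>) / (\<i> * of_int m))"
  have "((\<lambda>\<theta>. exp (of_int m * Complex \<rho> \<theta>)) has_integral (F pi - F (-pi))) {-pi..pi}"
  proof (rule fundamental_theorem_of_calculus)
    fix x :: real
    show "(F has_vector_derivative exp (of_int m * Complex \<rho> x)) (at x within {-pi..pi})"
      unfolding F_def Complex_eq using False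
      by (auto intro!: derivative_eq_intros has_vector_derivative_real_field simp: field_simps)
  qed simp
  moreover have "exp (of_int m * (\<i> * of_real pi)) = exp (of_int m * (\<i> * of_real (-pi)) :: complex)"
    by (subst exp_eq) (auto intro!: exI[of _ m] simp: algebra_simps)
  then have "F pi = F (-pi)"
    unfolding F_def Complex_eq by (simp add: ring_distribs exp_add exp_diff exp_minus divide_inverse)
  ultimately show ?thesis using False by (simp add: integral_unique)
qed (simp add: scaleR_conv_of_real)

text \<open>In the binomial expansion of the power, orthogonality of the exponentials keeps the single
  index \<open>i\<close> with \<open>2 * i = k + n\<close>. Such an index exists in \<open>{0..k}\<close> exactly when \<open>k\<close> is \<open>2 * j + \<bar>n\<bar>\<close>
  for some \<open>j\<close>.\<close>

lemma integral_power_int: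
  fixes \<rho> :: real and n :: int and k :: nat
  defines "N \<equiv> nat \<bar>n\<bar>"
  shows "integral {-pi..pi} (\<lambda>\<theta>. (exp (Complex \<rho> \<theta>) + exp (- Complex \<rho> \<theta>)) ^ k
            * exp (- of_int n * Complex \<rho> \<theta>)) =
         (if \<exists>j. k = 2 * j + N then 2 * pi * real (k choose ((k - N) div 2)) else 0)"
proof -
  have expand: "(exp (Complex \<rho> \<theta>) + exp (- Complex \<rho> \<theta>)) ^ k * exp (- of_int n * Complex \<rho> \<theta>)
      = (\<Sum>i\<le>k. of_nat (k choose i) * exp (of_int (2 * int i - int k - n) * Complex \<rho> \<theta>))" for \<theta>
  proof -
    have "exp (Complex \<rho> \<theta>) ^ i * exp (- Complex \<rho> \<theta>) ^ (k - i) * exp (- of_int n * Complex \<rho> \<theta>)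
       = exp (of_int (2 * int i - int k - n) * Complex \<rho> \<theta>)" if "i \<le> k" for i
      using that by (simp add: exp_of_nat_mult [symmetric] exp_add [symmetric] algebra_simps of_nat_diff)
    then show ?thesis
      by (simp add: binomial_ring sum_distrib_right mult.assoc)
  qed
  have "integral {-pi..pi} (\<lambda>\<theta>. \<Sum>i\<le>k. of_nat (k choose i) * exp (of_int (2 * int i - int k - n) * Complex \<rho> \<theta>))
     = (\<Sum>i\<le>k. of_nat (k choose i) * integral {-pi..pi} (\<lambda>\<theta>. exp (of_int (2 * int i - int k - n) * Complex \<rho> \<theta>)))"
    by (subst integral_sum) (auto intro!: integrable_continuous_real continuous_intros)
  also have "\<dots> = complex_of_real (\<Sum>i\<le>k. if 2 * int i = int k + n then 2 * pi * real (k choose i) else 0)"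
    unfolding integral_exp_int by (auto simp: algebra_simps intro!: sum.cong)
  also have "(\<Sum>i\<le>k. if 2 * int i = int k + n then 2 * pi * real (k choose i) else 0) =
      (if \<exists>j. k = 2 * j + N then 2 * pi * real (k choose ((k - N) div 2)) else 0)"
  proof (cases "\<exists>j. k = 2 * j + N")
    case True
    then obtain j where j: "k = 2 * j + N" by blast
    define i0 where "i0 = (if n \<ge> 0 then j + N else j)"
    have i0: "2 * int i = int k + n \<longleftrightarrow> i = i0" for i
      unfolding i0_def j N_def by auto
    have "(\<Sum>i\<le>k. if 2 * int i = int k + n then 2 * pi * real (k choose i) else 0)
        = 2 * pi * real (k choose i0)"
      unfolding i0 by (auto simp: i0_def j)
    also have "k choose i0 = k choose j"
      using binomial_symmetric[of j k] by (auto simp: i0_def j)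
    finally show ?thesis using True by (auto simp: j)
  next
    case False
    have "2 * int i \<noteq> int k + n" if "i \<le> k" for i
    proof
      assume *: "2 * int i = int k + n"
      have "k = 2 * (if n \<ge> 0 then i - N else i) + N"
        using * that unfolding N_def by auto
      with False show False by blast
    qed
    then show ?thesis using False by simp
  qed
  finally show ?thesis unfolding expand .
qed

text \<open>The generating function of the Bessel functions, read backwards: expand
  \<open>exp (t * (exp z + exp (- z)))\<close> into powers of \<open>t\<close> and integrate term by term. The contour
  \<open>Re z = \<rho>\<close> is arbitrary, which is what all decay estimates below exploit.\<close>

theorem heat_kernel_contour_integral:
  "complex_of_real (2 * pi * heat_kernel n t) =
     integral {-pi..pi} (\<lambda>\<theta>. exp (of_real t * heat_symbol (Complex \<rho> \<theta>)) * exp (- of_int n * Complex \<rho> \<theta>))"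
proof -
  define N where "N = nat \<bar>n\<bar>"
  define w where "w = (\<lambda>\<theta>. exp (Complex \<rho> \<theta>) + exp (- Complex \<rho> \<theta>))"
  define e where "e = (\<lambda>\<theta>. exp (- of_int n * Complex \<rho> \<theta>))"
  define g where "g = (\<lambda>k \<theta>. of_real (t ^ k / fact k) * (w \<theta> ^ k * e \<theta>))"
  have cont: "continuous_on {-pi..pi} w" "continuous_on {-pi..pi} e"
    unfolding w_def e_def by (intro continuous_intros)+
  have norm_w: "norm (w \<theta>) \<le> 2 * exp \<bar>\<rho>\<bar>" for \<theta>
  proof -
    have "norm (w \<theta>) \<le> norm (exp (Complex \<rho> \<theta>)) + norm (exp (- Complex \<rho> \<theta>))"
      unfolding w_def by (rule norm_triangle_ineq)
    also have "\<dots> \<le> exp \<bar>\<rho>\<bar> + exp \<bar>\<rho>\<bar>" by (intro add_mono) auto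
    finally show ?thesis by simp
  qed
  have norm_e: "norm (e \<theta>) = exp (- of_int n * \<rho>)" for \<theta>
    by (simp add: e_def)
  have g_sums: "(\<lambda>k. g k \<theta>) sums (exp (of_real t * w \<theta>) * e \<theta>)" for \<theta>
  proof -
    have "(\<lambda>k. (of_real t * w \<theta>) ^ k /\<^sub>R fact k * e \<theta>) sums (exp (of_real t * w \<theta>) * e \<theta>)"
      by (intro sums_mult2 exp_converges)
    then show ?thesis
      by (simp add: g_def power_mult_distrib scaleR_conv_of_real divide_inverse mult_ac)
  qed
  have "uniform_limit {-pi..pi} (\<lambda>M \<theta>. \<Sum>k<M. g k \<theta>) (\<lambda>\<theta>. \<Sum>k. g k \<theta>) sequentially"
  proof (rule Weierstrass_m_test)
    show "norm (g k \<theta>) \<le> (\<bar>t\<bar> * (2 * exp \<bar>\<rho>\<bar>)) ^ k /\<^sub>R fact k * exp (- of_int n * \<rho>)" for k \<theta>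
    proof -
      have "norm (g k \<theta>) = \<bar>t\<bar> ^ k / fact k * (norm (w \<theta>) ^ k * exp (- of_int n * \<rho>))"
        by (simp add: g_def norm_mult norm_power norm_e norm_divide power_abs)
      also have "\<dots> \<le> \<bar>t\<bar> ^ k / fact k * ((2 * exp \<bar>\<rho>\<bar>) ^ k * exp (- of_int n * \<rho>))"
        by (intro mult_left_mono mult_right_mono power_mono norm_w) auto
      finally show ?thesis by (simp add: power_mult_distrib divide_inverse mult_ac)
    qed
    show "summable (\<lambda>k. (\<bar>t\<bar> * (2 * exp \<bar>\<rho>\<bar>)) ^ k /\<^sub>R fact k * exp (- of_int n * \<rho>))"
      by (intro summable_mult2 summable_exp_generic)
  qed
  then have "uniform_limit {-pi..pi} (\<lambda>M \<theta>. \<Sum>k<M. g k \<theta>) (\<lambda>\<theta>. exp (of_real t * w \<theta>) * e \<theta>) sequentially"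
    using g_sums by (simp add: sums_iff)
  then obtain I J where I: "\<And>M. ((\<lambda>\<theta>. \<Sum>k<M. g k \<theta>) has_integral I M) {-pi..pi}"
    and J: "((\<lambda>\<theta>. exp (of_real t * w \<theta>) * e \<theta>) has_integral J) {-pi..pi}" and lim: "I \<longlonglongrightarrow> J"
    by (rule uniform_limit_integral) (auto simp: g_def intro!: continuous_intros cont)
  define c where "c = (\<lambda>k. t ^ k / fact k * (if \<exists>j. k = 2 * j + N then 2 * pi * real (k choose ((k - N) div 2)) else 0))"
  have "I = (\<lambda>M. \<Sum>k<M. complex_of_real (c k))"
  proof
    fix M
    have "I M = integral {-pi..pi} (\<lambda>\<theta>. \<Sum>k<M. g k \<theta>)"
      by (rule integral_unique[symmetric, OF I])
    also have "\<dots> = (\<Sum>k<M. of_real (t ^ k / fact k) * integral {-pi..pi} (\<lambda>\<theta>. w \<theta> ^ k * e \<theta>))"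
      unfolding g_def by (subst integral_sum)
        (auto intro!: integrable_continuous_real continuous_intros cont)
    also have "\<dots> = (\<Sum>k<M. complex_of_real (c k))"
      unfolding w_def e_def integral_power_int c_def N_def by (intro sum.cong) auto
    finally show "I M = (\<Sum>k<M. complex_of_real (c k))" .
  qed
  with lim have "(\<lambda>k. complex_of_real (c k)) sums J" by (simp only: sums_def)
  moreover from this have "J = complex_of_real (\<Sum>k. c k)"
    using sums_of_real_iff summable_of_real_iff suminf_of_real sums_iff by metis
  ultimately have "c sums (\<Sum>k. c k)" using sums_of_real_iff by metis
  \<comment> \<open>Dropping the vanishing terms turns the series in powers of \<open>t\<close> into the Bessel series.\<close>
  then have "(\<lambda>j. c (2 * j + N)) sums (\<Sum>k. c k)"
    by (subst sums_mono_reindex) (auto simp: c_def strict_mono_def)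
  moreover have "c (2 * j + N) = 2 * pi * ((2 * t / 2) ^ (2 * j + N) / (fact j * fact (j + N)))" for j
    by (simp add: c_def binomial_fact field_simps)
  ultimately have "(\<lambda>j. 2 * pi * ((2 * t / 2) ^ (2 * j + N) / (fact j * fact (j + N)))) sums (\<Sum>k. c k)"
    by simp
  then have "(\<lambda>j. 2 * pi * ((2 * t / 2) ^ (2 * j + N) / (fact j * fact (j + N))) / (2 * pi)) sums ((\<Sum>k. c k) / (2 * pi))"
    by (rule sums_divide)
  then have "bessel_I n (2 * t) = (\<Sum>k. c k) / (2 * pi)"
    unfolding bessel_I_def N_def by (simp add: sums_iff)
  then have Jeq: "J = complex_of_real (2 * pi * bessel_I n (2 * t))"
    using \<open>J = complex_of_real (\<Sum>k. c k)\<close> by simp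
  have "exp (of_real t * heat_symbol (Complex \<rho> \<theta>)) * e \<theta>
      = of_real (exp (- 2 * t)) * (exp (of_real t * w \<theta>) * e \<theta>)" for \<theta>
    by (simp add: heat_symbol_def w_def exp_of_real exp_diff exp_minus field_simps flip: exp_add exp_of_real)
  moreover have "integral {-pi..pi} (\<lambda>\<theta>. of_real (exp (- 2 * t)) * (exp (of_real t * w \<theta>) * e \<theta>))
      = of_real (exp (- 2 * t)) * J"
    using J by (simp add: integral_unique)
  ultimately show ?thesis
    unfolding heat_kernel_def Jeq e_def by (simp add: mult_ac)
qed

section \<open>Gaussian integrals over the circle at the parabolic scale\<close>

lemma one_minus_cos_ge:
  assumes "\<bar>\<theta>\<bar> \<le> pi"
  shows "\<theta>\<^sup>2 / 8 \<le> 1 - cos \<theta>"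
proof -
  define x where "x = \<bar>\<theta>\<bar> / 2"
  have x: "0 \<le> x" "x \<le> pi / 2" using assms by (auto simp: x_def)
  have "\<bar>sin x - (\<Sum>m<3. sin_coeff m * x ^ m)\<bar> \<le> inverse (fact 3) * \<bar>x\<bar> ^ 3"
    by (rule Maclaurin_sin_bound)
  then have "x - x ^ 3 / 6 \<le> sin x"
    using x by (simp add: sin_coeff_def numeral_3_eq_3 abs_if split: if_splits)
  moreover have "x\<^sup>2 \<le> 3"
  proof -
    have "x \<le> 1.6" using x pi_less_4 pi_approx by simp
    then have "x\<^sup>2 \<le> 1.6\<^sup>2" using x by (intro power_mono) auto
    then show ?thesis by (simp add: power2_eq_square)
  qed
  then have "x * x\<^sup>2 \<le> x * 3" using x by (intro mult_left_mono) auto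
  ultimately have "x / 2 \<le> sin x" by (simp add: power3_eq_cube power2_eq_square)
  then have "(x / 2)\<^sup>2 \<le> (sin x)\<^sup>2" using x by (intro power_mono) auto
  moreover have "1 - cos (2 * x) = 2 * (sin x)\<^sup>2" by (simp add: cos_double_sin)
  moreover have "cos (2 * x) = cos \<theta>" by (simp add: x_def)
  moreover have "(x / 2)\<^sup>2 = \<theta>\<^sup>2 / 16" by (simp add: x_def power_divide)
  ultimately show ?thesis by simp
qed

lemma power_times_exp_bounded:
  fixes c :: real
  assumes "c > 0"
  obtains C where "C > 0" "\<And>u. u \<ge> 0 \<Longrightarrow> (1 + u) ^ k * exp (- c * u) \<le> C"
proof (cases k)
  case 0
  then show thesis using assms by (intro that[of 1]) auto
next
  case (Suc j)
  have "(1 + u) ^ k * exp (- c * u) \<le> (1 + k / c) ^ k" if "u \<ge> 0" for u :: real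
  proof -
    have "(1 + k / c) * (1 + c / k * u) = (1 + u) + (k / c + c / k * u)"
    proof -
      have "c \<noteq> 0" "real k \<noteq> 0" using assms Suc by auto
      then show ?thesis by (simp add: distrib_left distrib_right add_divide_distrib)
    qed
    moreover have "k / c + c / k * u \<ge> 0" using assms that by (intro add_nonneg_nonneg) auto
    ultimately have "1 + u \<le> (1 + k / c) * (1 + c / k * u)" by linarith
    also have "\<dots> \<le> (1 + k / c) * exp (c / k * u)"
      using assms by (intro mult_left_mono exp_ge_add_one_self) auto
    finally have "(1 + u) ^ k \<le> ((1 + k / c) * exp (c / k * u)) ^ k"
      using that by (intro power_mono) auto
    also have "\<dots> = (1 + k / c) ^ k * exp (c * u)"
    proof -
      have "real k \<noteq> 0" using Suc by simp
      then have "exp (c / k * u) ^ k = exp (c * u)" unfolding exp_of_nat_mult [symmetric] by simp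
      then show ?thesis unfolding power_mult_distrib by simp
    qed
    finally show ?thesis by (simp add: exp_minus field_simps)
  qed
  moreover have "(1 + k / c) ^ k > 0" using assms by (intro zero_less_power add_pos_nonneg) auto
  ultimately show thesis using that by blast
qed

text \<open>A smooth substitute for \<open>min 1 (1 / sqrt t)\<close>, the natural frequency of the heat flow at time \<open>t\<close>
  (on the integers no frequency above \<open>1\<close> matters). It serves as displacement of the contour.\<close>

definition heat_scale :: "real \<Rightarrow> real" where
  "heat_scale t = 1 / sqrt (1 + t)"

lemma heat_scale_pos: "t \<ge> 0 \<Longrightarrow> 0 < heat_scale t"
  and heat_scale_le_1: "t \<ge> 0 \<Longrightarrow> heat_scale t \<le> 1"
  and heat_scale_square: "t \<ge> 0 \<Longrightarrow> (heat_scale t)\<^sup>2 = 1 / (1 + t)"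
  by (auto simp: heat_scale_def power_divide)

lemma heat_scale_square_le: "t \<ge> 0 \<Longrightarrow> t * (heat_scale t)\<^sup>2 \<le> 1"
  by (simp add: heat_scale_square)

lemma integral_lorentz_le:
  fixes \<eta> :: real
  assumes "\<eta> > 0"
  shows "integral {-pi..pi} (\<lambda>\<theta>. 1 / (1 + (\<theta> / \<eta>)\<^sup>2)) \<le> pi * \<eta>"
proof -
  have "((\<lambda>\<theta>. 1 / (1 + (\<theta> / \<eta>)\<^sup>2)) has_integral (\<eta> * arctan (pi / \<eta>) - \<eta> * arctan (-pi / \<eta>))) {-pi..pi}"
  proof (rule fundamental_theorem_of_calculus)
    fix x :: real
    have "((\<lambda>\<theta>. \<eta> * arctan (\<theta> / \<eta>)) has_real_derivative (1 / (1 + (x / \<eta>)\<^sup>2))) (at x within {-pi..pi})"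
      using assms by (auto intro!: derivative_eq_intros simp: divide_inverse)
    then show "((\<lambda>\<theta>. \<eta> * arctan (\<theta> / \<eta>)) has_vector_derivative (1 / (1 + (x / \<eta>)\<^sup>2))) (at x within {-pi..pi})"
      by (simp add: has_real_derivative_iff_has_vector_derivative)
  qed simp
  then have "integral {-pi..pi} (\<lambda>\<theta>. 1 / (1 + (\<theta> / \<eta>)\<^sup>2)) = \<eta> * (2 * arctan (pi / \<eta>))"
    by (simp add: integral_unique arctan_minus)
  also have "\<dots> \<le> \<eta> * pi"
    using assms arctan_ubound[of "pi / \<eta>"] by (intro mult_left_mono) auto
  finally show ?thesis by (simp add: mult.commute)
qed

text \<open>On the circle \<open>1 - cos \<theta> \<ge> \<theta>\<^sup>2 / 8\<close>, so in the variable \<open>u = \<bar>\<theta>\<bar> / heat_scale t\<close> the exponential is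
  dominated by \<open>exp (- u\<^sup>2 / 4)\<close> up to a constant factor, and this absorbs any power of \<open>1 + u\<close>.\<close>

lemma heat_angular_integral_le:
  obtains C where "C > 0" "\<And>t. t \<ge> 0 \<Longrightarrow>
    integral {-pi..pi} (\<lambda>\<theta>. exp (- 2 * t * (1 - cos \<theta>)) * (heat_scale t + \<bar>\<theta>\<bar>) ^ k)
      \<le> C * heat_scale t ^ (k + 1)"
proof -
  \<comment> \<open>Two more powers than in the integrand leave the integrable factor \<open>1 / (1 + u\<^sup>2)\<close>.\<close>
  obtain A where A: "A > 0" "\<And>u :: real. u \<ge> 0 \<Longrightarrow> (1 + u) ^ (k + 2) * exp (- (1 / 4) * u) \<le> A"
    using power_times_exp_bounded[of "1 / 4" "k + 2"] by (metis zero_less_divide_1_iff zero_less_numeral)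
  \<comment> \<open>The first factor pays for \<open>t = 1 / \<eta>\<^sup>2 - 1\<close> instead of \<open>1 / \<eta>\<^sup>2\<close>, the second for \<open>u\<^sup>2 \<ge> u - 1\<close>.\<close>
  define D where "D = exp (pi\<^sup>2 / 4) * exp (1 / 4) * A"
  have "D > 0" using A by (simp add: D_def)
  show thesis
  proof (rule that[of "D * pi"])
    fix t :: real assume t: "t \<ge> 0"
    define \<eta> where "\<eta> = heat_scale t"
    have \<eta>: "\<eta> > 0" "\<eta>\<^sup>2 = 1 / (1 + t)" using t by (auto simp: \<eta>_def heat_scale_pos heat_scale_square)
    have "integral {-pi..pi} (\<lambda>\<theta>. exp (- 2 * t * (1 - cos \<theta>)) * (\<eta> + \<bar>\<theta>\<bar>) ^ k)
        \<le> integral {-pi..pi} (\<lambda>\<theta>. D * \<eta> ^ k * (1 / (1 + (\<theta> / \<eta>)\<^sup>2)))"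
    proof (rule integral_le)
      fix \<theta> :: real assume "\<theta> \<in> {-pi..pi}"
      then have \<theta>: "\<bar>\<theta>\<bar> \<le> pi" by auto
      define u where "u = \<bar>\<theta>\<bar> / \<eta>"
      have u: "u \<ge> 0" "\<bar>\<theta>\<bar> = \<eta> * u" using \<eta> by (auto simp: u_def)
      have "- 2 * t * (1 - cos \<theta>) \<le> - t * \<theta>\<^sup>2 / 4"
        using mult_left_mono[OF one_minus_cos_ge[OF \<theta>] t] by simp
      also have "- t * \<theta>\<^sup>2 / 4 = \<theta>\<^sup>2 / 4 - u\<^sup>2 / 4"
        using t by (simp add: u_def power_divide \<eta>(2) algebra_simps add_divide_distrib)
      also have "\<dots> \<le> pi\<^sup>2 / 4 + (1 / 4 - u / 4)"
      proof -
        have "\<theta>\<^sup>2 \<le> pi\<^sup>2" using power_mono[OF \<theta>, of 2] by simp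
        moreover have "u \<le> 1 + u\<^sup>2"
          using zero_le_power2[of "u - 1"] u by (simp add: power2_eq_square algebra_simps)
        ultimately show ?thesis by simp
      qed
      finally have "exp (- 2 * t * (1 - cos \<theta>)) \<le> exp (pi\<^sup>2 / 4) * exp (1 / 4) * exp (- (1 / 4) * u)"
        by (simp flip: exp_add)
      then have "exp (- 2 * t * (1 - cos \<theta>)) * (\<eta> + \<bar>\<theta>\<bar>) ^ k
          \<le> exp (pi\<^sup>2 / 4) * exp (1 / 4) * exp (- (1 / 4) * u) * (\<eta> + \<bar>\<theta>\<bar>) ^ k"
        using \<eta> by (intro mult_right_mono) auto
      also have "\<dots> = exp (pi\<^sup>2 / 4) * exp (1 / 4) * \<eta> ^ k * ((1 + u) ^ k * exp (- (1 / 4) * u))"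
      proof -
        have "\<eta> + \<bar>\<theta>\<bar> = \<eta> * (1 + u)" unfolding u(2) by (simp add: algebra_simps)
        then show ?thesis by (simp only: power_mult_distrib mult_ac)
      qed
      also have "\<dots> \<le> exp (pi\<^sup>2 / 4) * exp (1 / 4) * \<eta> ^ k * (A / (1 + u\<^sup>2))"
      proof (intro mult_left_mono)
        have "(1 + u) ^ k * exp (- (1 / 4) * u) * (1 + u\<^sup>2) \<le> (1 + u) ^ k * exp (- (1 / 4) * u) * (1 + u) ^ 2"
          using u by (intro mult_left_mono) (auto simp: power2_eq_square algebra_simps)
        also have "\<dots> \<le> A" using A(2)[OF u(1)] by (simp only: power_add mult_ac)
        finally show "(1 + u) ^ k * exp (- (1 / 4) * u) \<le> A / (1 + u\<^sup>2)"
          by (subst pos_le_divide_eq) (auto intro: add_pos_nonneg)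
      qed (use \<eta> in auto)
      also have "\<dots> = D * \<eta> ^ k * (1 / (1 + (\<theta> / \<eta>)\<^sup>2))"
        by (simp add: D_def u_def power_divide)
      finally show "exp (- 2 * t * (1 - cos \<theta>)) * (\<eta> + \<bar>\<theta>\<bar>) ^ k \<le> D * \<eta> ^ k * (1 / (1 + (\<theta> / \<eta>)\<^sup>2))" .
    qed (use \<eta> in \<open>auto intro!: integrable_continuous_real continuous_intros simp: add_nonneg_eq_0_iff\<close>)
    also have "\<dots> = D * \<eta> ^ k * integral {-pi..pi} (\<lambda>\<theta>. 1 / (1 + (\<theta> / \<eta>)\<^sup>2))"
      by (rule integral_mult_right)
    also have "\<dots> \<le> D * \<eta> ^ k * (pi * \<eta>)"
      using \<eta> \<open>D > 0\<close> by (intro mult_left_mono integral_lorentz_le) auto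
    finally show "integral {-pi..pi} (\<lambda>\<theta>. exp (- 2 * t * (1 - cos \<theta>)) * (heat_scale t + \<bar>\<theta>\<bar>) ^ k)
      \<le> D * pi * heat_scale t ^ (k + 1)"
      by (simp add: \<eta>_def mult_ac)
  qed (use \<open>D > 0\<close> in auto)
qed

text \<open>Both the time derivatives of the semigroup and the energy identity behind the square function
  are instances of this form of differentiation under the integral sign.\<close>

lemma integral_exp_has_vector_derivative:
  fixes u h :: "real \<Rightarrow> complex"
  assumes [continuous_intros]: "continuous_on {a..b} u" "continuous_on {a..b} h"
  shows "((\<lambda>t. integral {a..b} (\<lambda>\<theta>. exp (of_real t * u \<theta>) * h \<theta>)) has_vector_derivative
     integral {a..b} (\<lambda>\<theta>. exp (of_real t * u \<theta>) * (u \<theta> * h \<theta>))) (at t)"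
proof -
  have *: "continuous_on (UNIV \<times> cbox a b) (\<lambda>x. u (snd x))" "continuous_on (UNIV \<times> cbox a b) (\<lambda>x. h (snd x))"
    by (rule continuous_on_compose2[OF assms(1)] continuous_on_compose2[OF assms(2)];
        auto intro: continuous_intros)+
  have "((\<lambda>t. integral (cbox a b) (\<lambda>\<theta>. exp (of_real t * u \<theta>) * h \<theta>)) has_vector_derivative
     integral (cbox a b) (\<lambda>\<theta>. exp (of_real t * u \<theta>) * (u \<theta> * h \<theta>))) (at t within UNIV)"
  proof (rule leibniz_rule_vector_derivative)
    show "((\<lambda>t. exp (of_real t * u \<theta>) * h \<theta>) has_vector_derivative exp (of_real t * u \<theta>) * (u \<theta> * h \<theta>)) (at t within UNIV)" for t \<theta>
      by (rule has_vector_derivative_real_field) (auto intro!: derivative_eq_intros)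
    show "continuous_on (UNIV \<times> cbox a b) (\<lambda>(t, \<theta>). exp (of_real t * u \<theta>) * (u \<theta> * h \<theta>))"
      unfolding case_prod_beta by (intro continuous_intros *)
  qed (auto intro!: integrable_continuous_real continuous_intros)
  then show ?thesis by simp
qed

section \<open>Off-diagonal decay from vanishing moments\<close>

text \<open>For \<open>S\<close> containing the support of \<open>b\<close> this is the \<open>j\<close>-th time derivative of the heat flow of \<open>b\<close>,
  written on the contour \<open>Re z = \<rho>\<close>.\<close>

definition heat_contour ::
  "int set \<Rightarrow> (int \<Rightarrow> complex) \<Rightarrow> real \<Rightarrow> nat \<Rightarrow> real \<Rightarrow> int \<Rightarrow> complex" where
  "heat_contour S b \<rho> j t n = integral {-pi..pi} (\<lambda>\<theta>. exp (of_real t * heat_symbol (Complex \<rho> \<theta>)) *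
     (heat_symbol (Complex \<rho> \<theta>) ^ j * (\<Sum>m\<in>S. b m * exp (of_int (m - n) * Complex \<rho> \<theta>)))) / (2 * pi)"

lemma heat_op_finite_support:
  assumes "finite S" "{m. b m \<noteq> 0} \<subseteq> S"
  shows "heat_op t b n = (\<Sum>m\<in>S. complex_of_real (heat_kernel (n - m) t) * b m)"
proof -
  have "heat_op t b n = (\<Sum>\<^sub>\<infinity>m\<in>S. complex_of_real (heat_kernel (n - m) t) * b m)"
    unfolding heat_op_def by (rule infsum_cong_neutral) (use assms in auto)
  with assms show ?thesis by simp
qed

lemma heat_op_eq_contour:
  assumes "finite S" "{m. b m \<noteq> 0} \<subseteq> S"
  shows "heat_op t b n = heat_contour S b \<rho> 0 t n"
proof -
  have "heat_contour S b \<rho> 0 t n = integral {-pi..pi} (\<lambda>\<theta>. \<Sum>m\<in>S. b m *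
     (exp (of_real t * heat_symbol (Complex \<rho> \<theta>)) * exp (- of_int (n - m) * Complex \<rho> \<theta>))) / (2 * pi)"
    unfolding heat_contour_def by (simp add: sum_distrib_left mult_ac)
  also have "\<dots> = (\<Sum>m\<in>S. b m * complex_of_real (2 * pi * heat_kernel (n - m) t)) / (2 * pi)"
    unfolding heat_kernel_contour_integral[of _ _ \<rho>] using assms
    by (subst integral_sum) (auto intro!: integrable_continuous_real continuous_intros)
  also have "\<dots> = heat_op t b n"
    unfolding heat_op_finite_support[OF assms] by (simp add: sum_divide_distrib mult_ac)
  finally show ?thesis ..
qed

lemma heat_contour_has_vector_derivative:
  "((\<lambda>t. heat_contour S b \<rho> j t n) has_vector_derivative heat_contour S b \<rho> (Suc j) t n) (at t)"
proof -
  have "((\<lambda>t. integral {-pi..pi} (\<lambda>\<theta>. exp (of_real t * heat_symbol (Complex \<rho> \<theta>)) *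
     (heat_symbol (Complex \<rho> \<theta>) ^ j * (\<Sum>m\<in>S. b m * exp (of_int (m - n) * Complex \<rho> \<theta>)))))
     has_vector_derivative
     integral {-pi..pi} (\<lambda>\<theta>. exp (of_real t * heat_symbol (Complex \<rho> \<theta>)) * (heat_symbol (Complex \<rho> \<theta>) *
     (heat_symbol (Complex \<rho> \<theta>) ^ j * (\<Sum>m\<in>S. b m * exp (of_int (m - n) * Complex \<rho> \<theta>)))))) (at t)"
    by (rule integral_exp_has_vector_derivative) (auto intro!: continuous_intros)
  from has_vector_derivative_divide[OF this, of "2 * pi"] show ?thesis
    by (simp add: heat_contour_def mult.assoc)
qed

lemma heat_op_has_vector_derivative:
  assumes "finite S" "{m. b m \<noteq> 0} \<subseteq> S"
  shows "((\<lambda>t. heat_op t b n) has_vector_derivative heat_contour S b \<rho> 1 t n) (at t)"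
  using heat_contour_has_vector_derivative[of S b \<rho> 0 n t] heat_op_eq_contour[OF assms, of _ n \<rho>]
  by simp

lemma continuous_on_heat_contour [continuous_intros]: "continuous_on A (\<lambda>t. heat_contour S b \<rho> j t n)"
  by (intro continuous_at_imp_continuous_on ballI
      has_vector_derivative_continuous[OF heat_contour_has_vector_derivative])

text \<open>The sign makes \<open>exp (- x * z)\<close> decay on the contour \<open>Re z = heat_shift x t\<close>.\<close>

definition heat_shift :: "int \<Rightarrow> real \<Rightarrow> real" where
  "heat_shift x t = (if x \<ge> 0 then heat_scale t else - heat_scale t)"

text \<open>The central estimate. Put \<open>x = n - n0\<close> and \<open>\<eta> = heat_scale t\<close>, and factor \<open>exp (- x * z)\<close> out of the sum
  over \<open>S\<close>; on the chosen contour it has modulus \<open>exp (- \<eta> * \<bar>x\<bar>)\<close>. In what remains the vanishing moments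
  allow subtracting from each exponential its Taylor polynomial of degree below \<open>K\<close>, which leaves
  \<open>(R * (\<eta> + \<bar>\<theta>\<bar>)) ^ K\<close> times an exponential that half of the decay compensates. Each time derivative
  contributes a factor \<open>(\<eta> + \<bar>\<theta>\<bar>)\<^sup>2\<close>, and the Gaussian integral in \<open>\<theta>\<close> turns all powers of \<open>\<eta> + \<bar>\<theta>\<bar>\<close>
  into powers of \<open>\<eta>\<close>. The case \<open>K = 0\<close>, \<open>R = 0\<close> bounds the kernel itself.\<close>

theorem heat_contour_far_bound:
  obtains C where "C > 0"
    "\<And>t S b n0 n R. t \<ge> 0 \<Longrightarrow> finite S \<Longrightarrow> R \<ge> 0 \<Longrightarrow>
       (\<And>m. m \<in> S \<Longrightarrow> real_of_int \<bar>m - n0\<bar> \<le> R) \<Longrightarrow>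
       (\<And>k. k < K \<Longrightarrow> (\<Sum>m\<in>S. of_int (m - n0) ^ k * b m) = 0) \<Longrightarrow>
       2 * R \<le> real_of_int \<bar>n - n0\<bar> \<Longrightarrow>
       norm (heat_contour S b (heat_shift (n - n0) t) j t n) \<le>
         C * (\<Sum>m\<in>S. norm (b m)) * R ^ K * heat_scale t ^ (K + 2 * j + 1)
           * exp (- heat_scale t * real_of_int \<bar>n - n0\<bar> / 2)"
proof -
  obtain A where A: "A > 0" "\<And>t. t \<ge> 0 \<Longrightarrow>
    integral {-pi..pi} (\<lambda>\<theta>. exp (- 2 * t * (1 - cos \<theta>)) * (heat_scale t + \<bar>\<theta>\<bar>) ^ (K + 2 * j))
      \<le> A * heat_scale t ^ (K + 2 * j + 1)"
    by (rule heat_angular_integral_le[of "K + 2 * j"]) blast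
  define e :: real where "e = exp 1"
  define D where "D = exp (2 * e) * (2 * e) ^ j"
  have "e > 0" "D > 0" by (auto simp: D_def e_def)
  show thesis
  proof (rule that[of "D * A / (2 * pi)"])
    fix t :: real and S and b :: "int \<Rightarrow> complex" and n0 n :: int and R :: real
    assume t: "t \<ge> 0" and S: "finite S" and R: "R \<ge> 0"
      and supp: "\<And>m. m \<in> S \<Longrightarrow> real_of_int \<bar>m - n0\<bar> \<le> R"
      and mom: "\<And>k. k < K \<Longrightarrow> (\<Sum>m\<in>S. of_int (m - n0) ^ k * b m) = 0"
      and far: "2 * R \<le> real_of_int \<bar>n - n0\<bar>"
    define \<eta> where "\<eta> = heat_scale t"
    define \<rho> where "\<rho> = heat_shift (n - n0) t"
    define x where "x = real_of_int \<bar>n - n0\<bar>"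
    define B where "B = (\<Sum>m\<in>S. norm (b m))"
    have \<eta>: "0 < \<eta>" "\<eta> \<le> 1" "t * \<eta>\<^sup>2 \<le> 1"
      using t by (auto simp: \<eta>_def heat_scale_pos heat_scale_le_1 heat_scale_square_le)
    have \<rho>: "\<bar>\<rho>\<bar> = \<eta>" "real_of_int (n0 - n) * \<rho> = - \<eta> * x"
      using \<eta> by (auto simp: \<rho>_def heat_shift_def \<eta>_def[symmetric] x_def abs_if algebra_simps)
    have B: "B \<ge> 0" unfolding B_def by (intro sum_nonneg) auto
    define P where "P = (\<lambda>\<theta>. \<Sum>m\<in>S. b m * exp (of_int (m - n) * Complex \<rho> \<theta>))"
    define M where "M = D * B * R ^ K * exp (- \<eta> * x / 2)"
    have M: "M \<ge> 0" using \<open>D > 0\<close> B R by (simp add: M_def)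
    have bound: "norm (exp (of_real t * heat_symbol (Complex \<rho> \<theta>)) * (heat_symbol (Complex \<rho> \<theta>) ^ j * P \<theta>))
        \<le> M * (exp (- 2 * t * (1 - cos \<theta>)) * (\<eta> + \<bar>\<theta>\<bar>) ^ (K + 2 * j))" for \<theta>
    proof -
      define \<zeta> where "\<zeta> = Complex \<rho> \<theta>"
      define L where "L = \<eta> + \<bar>\<theta>\<bar>"
      have \<zeta>: "norm \<zeta> \<le> L" "L \<ge> 0"
        using cmod_le[of \<zeta>] \<eta> \<rho> by (auto simp: \<zeta>_def L_def)
      \<comment> \<open>The contour displacement costs a bounded factor because \<open>t * \<eta>\<^sup>2 \<le> 1\<close>.\<close>
      have 1: "norm (exp (of_real t * heat_symbol \<zeta>)) \<le> exp (2 * e) * exp (- 2 * t * (1 - cos \<theta>))"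
      proof -
        have "Re (of_real t * heat_symbol \<zeta>) \<le> t * (2 * exp \<eta> * \<eta>\<^sup>2 - 2 * (1 - cos \<theta>))"
        proof -
          have "\<rho>\<^sup>2 = \<eta>\<^sup>2" unfolding \<rho>(1)[symmetric] by simp
          then show ?thesis
            using mult_left_mono[OF Re_heat_symbol_le[of \<rho> \<theta>] t] \<rho>(1) by (simp add: \<zeta>_def)
        qed
        also have "\<dots> = 2 * exp \<eta> * (t * \<eta>\<^sup>2) - 2 * t * (1 - cos \<theta>)" by (simp add: algebra_simps)
        also have "2 * exp \<eta> * (t * \<eta>\<^sup>2) \<le> 2 * e * 1"
          using \<eta> t by (intro mult_mono) (auto simp: e_def)
        finally show ?thesis by (simp flip: exp_add)
      qed
      have 2: "norm (heat_symbol \<zeta> ^ j) \<le> (2 * e) ^ j * L ^ (2 * j)"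
      proof -
        have "norm (heat_symbol \<zeta>) \<le> 2 * exp \<bar>Re \<zeta>\<bar> * norm \<zeta> ^ 2" by (rule norm_heat_symbol_le)
        also have "\<dots> \<le> 2 * e * L ^ 2"
          using \<zeta> \<rho> \<eta> by (intro mult_mono power_mono) (auto simp: e_def \<zeta>_def)
        finally have "norm (heat_symbol \<zeta>) ^ j \<le> (2 * e * L ^ 2) ^ j" by (intro power_mono) auto
        then show ?thesis by (simp add: norm_power power_mult_distrib power_mult)
      qed
      \<comment> \<open>Half of the decay \<open>exp (- \<eta> * x)\<close> survives, since \<open>\<bar>m - n0\<bar> \<le> x / 2\<close> on the support.\<close>
      have 3: "norm (P \<theta>) \<le> exp (- \<eta> * x / 2) * (B * (R ^ K * L ^ K))"
      proof -
        define T where "T = (\<lambda>m. exp (of_int (m - n0) * \<zeta>) - (\<Sum>k<K. (of_int (m - n0) * \<zeta>) ^ k / fact k))"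
        have "(\<Sum>m\<in>S. b m * (\<Sum>k<K. (of_int (m - n0) * \<zeta>) ^ k / fact k))
           = (\<Sum>k<K. \<Sum>m\<in>S. b m * ((of_int (m - n0) * \<zeta>) ^ k / fact k))"
          by (subst sum.swap) (simp add: sum_distrib_left)
        also have "\<dots> = (\<Sum>k<K. (\<zeta> ^ k / fact k) * (\<Sum>m\<in>S. of_int (m - n0) ^ k * b m))"
          by (simp add: sum_distrib_left power_mult_distrib mult_ac)
        also have "\<dots> = 0" by (simp add: mom del: of_int_diff)
        finally have "P \<theta> = exp (of_int (n0 - n) * \<zeta>) * (\<Sum>m\<in>S. b m * T m)"
          by (simp add: P_def T_def \<zeta>_def[symmetric] right_diff_distrib sum_subtractf sum_distrib_left
              del: of_int_diff)
            (auto intro!: sum.cong simp flip: exp_add simp: algebra_simps)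
        also have "norm \<dots> = exp (- \<eta> * x) * norm (\<Sum>m\<in>S. b m * T m)"
          using \<rho>(2) by (simp add: norm_mult \<zeta>_def)
        also have "norm (\<Sum>m\<in>S. b m * T m) \<le> (\<Sum>m\<in>S. norm (b m) * (exp (\<eta> * x / 2) * (R ^ K * L ^ K)))"
        proof (rule sum_norm_le)
          fix m assume m: "m \<in> S"
          define d where "d = real_of_int \<bar>m - n0\<bar>"
          have d: "d \<le> R" "d \<ge> 0" using supp[OF m] by (auto simp: d_def)
          have "norm (T m) \<le> exp \<bar>Re (of_int (m - n0) * \<zeta>)\<bar> * norm (of_int (m - n0) * \<zeta>) ^ K"
            unfolding T_def by (rule norm_exp_minus_Taylor_le)
          also have "\<bar>Re (of_int (m - n0) * \<zeta>)\<bar> = d * \<eta>"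
            using \<rho>(1) by (simp add: \<zeta>_def abs_mult d_def)
          also have "norm (of_int (m - n0) * \<zeta>) = d * norm \<zeta>"
            unfolding norm_mult d_def by (metis norm_of_int of_int_abs)
          also have "exp (d * \<eta>) * (d * norm \<zeta>) ^ K \<le> exp (\<eta> * x / 2) * (R * L) ^ K"
          proof (intro mult_mono power_mono)
            have "d * \<eta> \<le> (x / 2) * \<eta>"
              using d far \<eta> by (intro mult_right_mono) (auto simp: x_def)
            then show "exp (d * \<eta>) \<le> exp (\<eta> * x / 2)" by (simp add: mult_ac)
          qed (use d \<zeta> R in auto)
          finally show "norm (b m * T m) \<le> norm (b m) * (exp (\<eta> * x / 2) * (R ^ K * L ^ K))"
            unfolding norm_mult power_mult_distrib by (intro mult_left_mono) auto
        qed
        also have "exp (- \<eta> * x) * (\<Sum>m\<in>S. norm (b m) * (exp (\<eta> * x / 2) * (R ^ K * L ^ K)))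
            = exp (- \<eta> * x) * exp (\<eta> * x / 2) * (B * (R ^ K * L ^ K))"
          unfolding B_def by (simp add: sum_distrib_right sum_distrib_left mult_ac)
        also have "exp (- \<eta> * x) * exp (\<eta> * x / 2) = exp (- \<eta> * x / 2)" by (simp flip: exp_add)
        finally show ?thesis by simp
      qed
      have "norm (exp (of_real t * heat_symbol \<zeta>) * (heat_symbol \<zeta> ^ j * P \<theta>))
         \<le> (exp (2 * e) * exp (- 2 * t * (1 - cos \<theta>))) *
            (((2 * e) ^ j * L ^ (2 * j)) * (exp (- \<eta> * x / 2) * (B * (R ^ K * L ^ K))))"
        unfolding norm_mult using \<zeta> \<open>e > 0\<close> by (intro mult_mono 1 2 3 mult_nonneg_nonneg) auto
      also have "\<dots> = M * (exp (- 2 * t * (1 - cos \<theta>)) * L ^ (K + 2 * j))"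
        by (simp add: M_def D_def power_add mult_ac)
      finally show ?thesis unfolding L_def \<zeta>_def .
    qed
    have "norm (heat_contour S b \<rho> j t n) =
       norm (integral {-pi..pi} (\<lambda>\<theta>. exp (of_real t * heat_symbol (Complex \<rho> \<theta>)) * (heat_symbol (Complex \<rho> \<theta>) ^ j * P \<theta>))) / (2 * pi)"
      by (simp add: heat_contour_def P_def norm_divide)
    also have "\<dots> \<le> integral {-pi..pi} (\<lambda>\<theta>. M * (exp (- 2 * t * (1 - cos \<theta>)) * (\<eta> + \<bar>\<theta>\<bar>) ^ (K + 2 * j))) / (2 * pi)"
      by (intro divide_right_mono integral_norm_bound_integral bound)
         (auto intro!: integrable_continuous_real continuous_intros simp: P_def)
    also have "\<dots> \<le> M * (A * \<eta> ^ (K + 2 * j + 1)) / (2 * pi)"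
      unfolding integral_mult_right using M A(2)[OF t] unfolding \<eta>_def
      by (intro divide_right_mono mult_left_mono) auto
    finally show "norm (heat_contour S b (heat_shift (n - n0) t) j t n) \<le>
         D * A / (2 * pi) * (\<Sum>m\<in>S. norm (b m)) * R ^ K * heat_scale t ^ (K + 2 * j + 1)
           * exp (- heat_scale t * real_of_int \<bar>n - n0\<bar> / 2)"
      unfolding \<rho>_def M_def \<eta>_def x_def B_def by (simp add: mult_ac)
  qed (use \<open>D > 0\<close> A in auto)
qed

section \<open>Uniform bounds for the heat kernel\<close>

lemma heat_contour_bound:
  assumes "t \<ge> 0"
  shows "norm (heat_contour S b 0 j t n) \<le> 4 ^ j * (\<Sum>m\<in>S. norm (b m))"
proof -
  define h where "h = (\<lambda>\<theta>. exp (of_real t * heat_symbol (Complex 0 \<theta>)) *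
     (heat_symbol (Complex 0 \<theta>) ^ j * (\<Sum>m\<in>S. b m * exp (of_int (m - n) * Complex 0 \<theta>))))"
  have bound: "norm (h \<theta>) \<le> 1 * (4 ^ j * (\<Sum>m\<in>S. norm (b m)))" for \<theta>
    unfolding h_def norm_mult norm_power
  proof (intro mult_mono power_mono)
    have "Re (heat_symbol (Complex 0 \<theta>)) \<le> 0" by (simp add: Re_heat_symbol)
    then show "norm (exp (of_real t * heat_symbol (Complex 0 \<theta>))) \<le> 1"
      using assms by (simp add: mult_nonneg_nonpos)
    have "norm (heat_symbol (Complex 0 \<theta>)) \<le> norm (exp (Complex 0 \<theta>)) + norm (exp (- Complex 0 \<theta>)) + norm (2 :: complex)"
      unfolding heat_symbol_def by (intro order_trans[OF norm_triangle_ineq4] add_mono norm_triangle_ineq order_refl)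
    then show "norm (heat_symbol (Complex 0 \<theta>)) \<le> 4" by simp
    show "norm (\<Sum>m\<in>S. b m * exp (of_int (m - n) * Complex 0 \<theta>)) \<le> (\<Sum>m\<in>S. norm (b m))"
      by (intro sum_norm_le) (simp add: norm_mult)
  qed (auto intro: sum_nonneg)
  have "norm (integral {-pi..pi} h) \<le> integral {-pi..pi} (\<lambda>_. 4 ^ j * (\<Sum>m\<in>S. norm (b m)))"
  proof (rule integral_norm_bound_integral)
    show "h integrable_on {-pi..pi}"
      unfolding h_def by (intro integrable_continuous_real continuous_intros)
  qed (use bound in auto)
  then have "norm (integral {-pi..pi} h) / (2 * pi) \<le> 4 ^ j * (\<Sum>m\<in>S. norm (b m))"
    by (simp add: field_simps)
  then show ?thesis by (simp add: heat_contour_def h_def norm_divide)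
qed

lemma norm_heat_op_le:
  assumes "t \<ge> 0" "finite S" "{m. b m \<noteq> 0} \<subseteq> S"
  shows "norm (heat_op t b n) \<le> (\<Sum>m\<in>S. norm (b m))"
  using heat_contour_bound[OF assms(1), of S b 0 n] by (simp add: heat_op_eq_contour[OF assms(2,3), of _ _ 0])

lemma heat_kernel_eq_heat_op: "complex_of_real (heat_kernel n t) = heat_op t (\<lambda>m. if m = 0 then 1 else 0) n"
  by (subst heat_op_finite_support[of "{0}"]) auto

lemma heat_kernel_le_1:
  assumes "t \<ge> 0"
  shows "\<bar>heat_kernel n t\<bar> \<le> 1"
  using norm_heat_op_le[OF assms, of "{0}" "\<lambda>m. if m = 0 then 1 else 0" n]
  by (simp flip: heat_kernel_eq_heat_op)

lemma heat_kernel_decay: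
  obtains C where "C > 0"
    "\<And>t n. t \<ge> 0 \<Longrightarrow> \<bar>heat_kernel n t\<bar> \<le> C * heat_scale t * exp (- heat_scale t * real_of_int \<bar>n\<bar> / 2)"
proof (rule heat_contour_far_bound[of 0 0])
  fix C :: real
  assume C: "C > 0" "\<And>t S b n0 n R. t \<ge> 0 \<Longrightarrow> finite S \<Longrightarrow> R \<ge> 0 \<Longrightarrow>
       (\<And>m. m \<in> S \<Longrightarrow> real_of_int \<bar>m - n0\<bar> \<le> R) \<Longrightarrow>
       (\<And>k. k < 0 \<Longrightarrow> (\<Sum>m\<in>S. of_int (m - n0) ^ k * b m) = 0) \<Longrightarrow>
       2 * R \<le> real_of_int \<bar>n - n0\<bar> \<Longrightarrow>
       norm (heat_contour S b (heat_shift (n - n0) t) 0 t n) \<le>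
         C * (\<Sum>m\<in>S. norm (b m)) * R ^ 0 * heat_scale t ^ (0 + 2 * 0 + 1)
           * exp (- heat_scale t * real_of_int \<bar>n - n0\<bar> / 2)"
  have "\<bar>heat_kernel n t\<bar> \<le> C * heat_scale t * exp (- heat_scale t * real_of_int \<bar>n\<bar> / 2)"
    if t: "t \<ge> 0" for t n
  proof -
    have "\<bar>heat_kernel n t\<bar> = norm (heat_op t (\<lambda>m. if m = 0 then 1 else 0) n)"
      by (simp flip: heat_kernel_eq_heat_op)
    also have "\<dots> = norm (heat_contour {0} (\<lambda>m. if m = 0 then 1 else 0) (heat_shift (n - 0) t) 0 t n)"
      by (subst heat_op_eq_contour[of "{0}"]) auto
    also have "\<dots> \<le> C * heat_scale t * exp (- heat_scale t * real_of_int \<bar>n\<bar> / 2)"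
      using C(2)[OF t, of "{0}" 0 0 "\<lambda>m. if m = 0 then 1 else 0" n] by simp
    finally show ?thesis .
  qed
  with C(1) show thesis using that by blast
qed

lemma sum_int_le_sum_nat:
  fixes h :: "nat \<Rightarrow> real"
  assumes "finite F" "\<And>i. h i \<ge> 0"
  shows "(\<Sum>m\<in>F. h (nat \<bar>m - n\<bar>)) \<le> 2 * (\<Sum>i\<in>(\<lambda>m. nat \<bar>m - n\<bar>) ` F. h i)"
proof -
  let ?g = "\<lambda>m. nat \<bar>m - n\<bar>"
  have half: "(\<Sum>m\<in>G. h (?g m)) \<le> (\<Sum>i\<in>?g ` F. h i)" if "G \<subseteq> F" "inj_on ?g G" for G
    using that assms by (subst sum.reindex[symmetric, unfolded o_def]) (auto intro!: sum_mono2)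
  have "(\<Sum>m\<in>F. h (?g m)) = (\<Sum>m\<in>{m\<in>F. m \<ge> n}. h (?g m)) + (\<Sum>m\<in>{m\<in>F. m < n}. h (?g m))"
    using assms(1) by (subst sum.union_disjoint[symmetric]) (auto intro!: sum.cong)
  also have "\<dots> \<le> (\<Sum>i\<in>?g ` F. h i) + (\<Sum>i\<in>?g ` F. h i)"
    by (intro add_mono half) (auto simp: inj_on_def)
  finally show ?thesis by simp
qed

text \<open>The exponential decay at distance \<open>1 / heat_scale t\<close> makes the sum a geometric series
  of total mass comparable to \<open>1 / heat_scale t\<close>, which the factor \<open>heat_scale t\<close> in front cancels.\<close>

lemma heat_kernel_l1_bounded:
  obtains C where "C > 0"
    "\<And>t n F. t \<ge> 0 \<Longrightarrow> finite F \<Longrightarrow> (\<Sum>m\<in>F. \<bar>heat_kernel (n - m) t\<bar>) \<le> C"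
proof (rule heat_kernel_decay)
  fix C :: real
  assume C: "C > 0" "\<And>t n. t \<ge> 0 \<Longrightarrow> \<bar>heat_kernel n t\<bar> \<le> C * heat_scale t * exp (- heat_scale t * real_of_int \<bar>n\<bar> / 2)"
  have "(\<Sum>m\<in>F. \<bar>heat_kernel (n - m) t\<bar>) \<le> 8 * C" if t: "t \<ge> 0" and F: "finite F" for t n and F :: "int set"
  proof -
    define \<eta> where "\<eta> = heat_scale t"
    have \<eta>: "0 < \<eta>" "\<eta> \<le> 1" using t by (auto simp: \<eta>_def heat_scale_pos heat_scale_le_1)
    define q where "q = exp (- \<eta> / 2)"
    have q: "0 < q" "q < 1" using \<eta> by (auto simp: q_def)
    \<comment> \<open>Summing the geometric series gives at most \<open>2 / (1 - q) \<le> 8 / \<eta>\<close>.\<close>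
    have "\<eta> / 4 \<le> 1 - q"
    proof -
      have "(1 + \<eta> / 2) * q \<le> 1"
        using exp_ge_add_one_self[of "\<eta> / 2"] by (simp add: q_def exp_minus field_simps)
      moreover have "\<eta> * q \<ge> \<eta> * (1 - \<eta> / 2)"
        using exp_ge_add_one_self[of "- \<eta> / 2"] \<eta> unfolding q_def by (intro mult_left_mono) auto
      moreover have "\<eta> * \<eta> \<le> \<eta> * 1" using \<eta> by (intro mult_left_mono) auto
      ultimately show ?thesis by (simp add: algebra_simps)
    qed
    have "(\<Sum>m\<in>F. \<bar>heat_kernel (n - m) t\<bar>) \<le> (\<Sum>m\<in>F. C * \<eta> * q ^ nat \<bar>m - n\<bar>)"
    proof (rule sum_mono)
      fix m
      have "\<bar>heat_kernel (n - m) t\<bar> \<le> C * \<eta> * exp (- \<eta> * real_of_int \<bar>n - m\<bar> / 2)"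
        using C(2)[OF t, of "n - m"] by (simp add: \<eta>_def)
      also have "exp (- \<eta> * real_of_int \<bar>n - m\<bar> / 2) = q ^ nat \<bar>m - n\<bar>"
        unfolding q_def exp_of_nat_mult[symmetric] by (simp add: abs_minus_commute algebra_simps)
      finally show "\<bar>heat_kernel (n - m) t\<bar> \<le> C * \<eta> * q ^ nat \<bar>m - n\<bar>" .
    qed
    also have "\<dots> = C * \<eta> * (\<Sum>m\<in>F. q ^ nat \<bar>m - n\<bar>)" by (simp add: sum_distrib_left)
    also have "\<dots> \<le> C * \<eta> * (2 * (\<Sum>i\<in>(\<lambda>m. nat \<bar>m - n\<bar>) ` F. q ^ i))"
      using C \<eta> q F by (intro mult_left_mono sum_int_le_sum_nat) auto
    also have "\<dots> \<le> C * \<eta> * (2 * (\<Sum>i. q ^ i))"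
      using C \<eta> q F by (intro mult_left_mono sum_le_suminf summable_geometric) auto
    also have "(\<Sum>i. q ^ i) = 1 / (1 - q)" using q by (intro suminf_geometric) auto
    also have "C * \<eta> * (2 * (1 / (1 - q))) \<le> 8 * C"
    proof -
      have "\<eta> / (1 - q) \<le> 4" using \<open>\<eta> / 4 \<le> 1 - q\<close> q by (simp add: field_simps)
      then have "C * 2 * (\<eta> / (1 - q)) \<le> C * 2 * 4" using C by (intro mult_left_mono) auto
      then show ?thesis by (simp add: mult_ac)
    qed
    finally show ?thesis .
  qed
  with C(1) show thesis using that[of "8 * C"] by auto
qed

section \<open>The square function on square-summable sequences\<close>

definition character :: "int \<Rightarrow> real \<Rightarrow> complex" where
  "character n \<theta> = exp (of_int n * Complex 0 \<theta>)"

lemma continuous_on_character [continuous_intros]: "continuous_on A (character n)"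
  unfolding character_def by (intro continuous_intros)

lemma cnj_character: "cnj (character n \<theta>) = character (- n) \<theta>"
  by (simp add: character_def exp_cnj Complex_eq)

lemma character_add: "character (m + n) \<theta> = character m \<theta> * character n \<theta>"
  by (simp add: character_def ring_distribs exp_add)

lemma integral_trig_poly_coeff:
  fixes b :: "int \<Rightarrow> complex"
  assumes "finite S"
  shows "integral {-pi..pi} (\<lambda>\<theta>. (\<Sum>m\<in>S. b m * character m \<theta>) * character (- n) \<theta>)
    = (if n \<in> S then 2 * pi * b n else 0)"
proof -
  have "integral {-pi..pi} (\<lambda>\<theta>. (\<Sum>m\<in>S. b m * character m \<theta>) * character (- n) \<theta>)
     = integral {-pi..pi} (\<lambda>\<theta>. \<Sum>m\<in>S. b m * character (m - n) \<theta>)"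
    using character_add[of _ "- n"] by (simp add: sum_distrib_right mult.assoc)
  also have "\<dots> = (\<Sum>m\<in>S. b m * integral {-pi..pi} (character (m - n)))"
    using assms by (subst integral_sum) (auto intro!: integrable_continuous_real continuous_intros)
  also have "\<dots> = (\<Sum>m\<in>S. if m = n then 2 * pi * b n else 0)"
    unfolding character_def integral_exp_int by (intro sum.cong) auto
  finally show ?thesis using assms by simp
qed

lemma integral_mult_cnj_trig_poly:
  assumes "finite S" and h: "continuous_on {-pi..pi} h"
  shows "integral {-pi..pi} (\<lambda>\<theta>. h \<theta> * cnj (\<Sum>m\<in>S. b m * character m \<theta>))
    = (\<Sum>m\<in>S. cnj (b m) * integral {-pi..pi} (\<lambda>\<theta>. h \<theta> * character (- m) \<theta>))"
proof -
  have "(\<lambda>\<theta>. h \<theta> * cnj (\<Sum>m\<in>S. b m * character m \<theta>)) =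
      (\<lambda>\<theta>. \<Sum>m\<in>S. cnj (b m) * (h \<theta> * character (- m) \<theta>))"
    by (simp add: cnj_character sum_distrib_left mult_ac)
  then show ?thesis
    using assms by (simp only:) (subst integral_sum;
      auto intro!: integrable_continuous_real continuous_intros)
qed

lemma integral_of_real_continuous:
  fixes a b :: real
  assumes "continuous_on {a..b} f"
  shows "integral {a..b} (\<lambda>x. complex_of_real (f x)) = complex_of_real (integral {a..b} f)"
  using integral_linear[OF integrable_continuous_real[OF assms] bounded_linear_of_real] by (simp add: o_def)

lemma parseval_trig_poly:
  assumes "finite S"
  shows "integral {-pi..pi} (\<lambda>\<theta>. (norm (\<Sum>m\<in>S. b m * character m \<theta>))\<^sup>2) = 2 * pi * (\<Sum>m\<in>S. (norm (b m))\<^sup>2)"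
proof -
  define s where "s = (\<lambda>\<theta>. \<Sum>m\<in>S. b m * character m \<theta>)"
  have s: "continuous_on {-pi..pi} s" unfolding s_def by (intro continuous_intros)
  have "complex_of_real (integral {-pi..pi} (\<lambda>\<theta>. (norm (s \<theta>))\<^sup>2)) = integral {-pi..pi} (\<lambda>\<theta>. s \<theta> * cnj (s \<theta>))"
    using s by (subst integral_of_real_continuous[symmetric]) (auto intro!: continuous_intros simp: complex_norm_square simp del: of_real_power)
  also have "\<dots> = (\<Sum>m\<in>S. cnj (b m) * integral {-pi..pi} (\<lambda>\<theta>. s \<theta> * character (- m) \<theta>))"
    unfolding s_def using s[unfolded s_def] by (rule integral_mult_cnj_trig_poly[OF assms])
  also have "\<dots> = complex_of_real (2 * pi * (\<Sum>m\<in>S. (norm (b m))\<^sup>2))"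
    unfolding s_def integral_trig_poly_coeff[OF assms]
    by (simp add: sum_distrib_left complex_norm_square mult_ac del: of_real_power)
  finally show ?thesis unfolding s_def of_real_eq_iff .
qed

text \<open>Expand the nonnegative integral of the squared distance between \<open>h\<close> and its partial Fourier sum.\<close>

lemma bessel_inequality:
  assumes "finite F" and h: "continuous_on {-pi..pi} h"
  shows "(\<Sum>n\<in>F. (norm (integral {-pi..pi} (\<lambda>\<theta>. h \<theta> * character (- n) \<theta>) / (2 * pi)))\<^sup>2)
     \<le> integral {-pi..pi} (\<lambda>\<theta>. (norm (h \<theta>))\<^sup>2) / (2 * pi)"
proof -
  define c where "c = (\<lambda>n. integral {-pi..pi} (\<lambda>\<theta>. h \<theta> * character (- n) \<theta>) / (2 * pi))"
  define s where "s = (\<lambda>\<theta>. \<Sum>n\<in>F. c n * character n \<theta>)"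
  define A where "A = (\<Sum>n\<in>F. (norm (c n))\<^sup>2)"
  have s: "continuous_on {-pi..pi} s" unfolding s_def by (intro continuous_intros)
  note [continuous_intros] = s h
  have "integral {-pi..pi} (\<lambda>\<theta>. h \<theta> * cnj (s \<theta>)) = complex_of_real (2 * pi * A)"
  proof -
    have "integral {-pi..pi} (\<lambda>\<theta>. h \<theta> * character (- n) \<theta>) = 2 * pi * c n" for n
      by (simp add: c_def)
    then show ?thesis
      unfolding s_def integral_mult_cnj_trig_poly[OF assms] A_def
      by (simp add: sum_distrib_left complex_norm_square mult_ac del: of_real_power)
  qed
  then have hs: "integral {-pi..pi} (\<lambda>\<theta>. Re (h \<theta> * cnj (s \<theta>))) = 2 * pi * A"
    using integral_linear[OF integrable_continuous_real bounded_linear_Re, of "-pi" pi "\<lambda>\<theta>. h \<theta> * cnj (s \<theta>)"]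
    by (simp add: o_def continuous_intros)
  have ss: "integral {-pi..pi} (\<lambda>\<theta>. (norm (s \<theta>))\<^sup>2) = 2 * pi * A"
    unfolding s_def A_def by (rule parseval_trig_poly[OF assms(1)])
  have "0 \<le> integral {-pi..pi} (\<lambda>\<theta>. (norm (h \<theta> - s \<theta>))\<^sup>2)"
    by (intro integral_nonneg integrable_continuous_real continuous_intros) auto
  also have "(\<lambda>\<theta>. (norm (h \<theta> - s \<theta>))\<^sup>2) = (\<lambda>\<theta>. (norm (h \<theta>))\<^sup>2 - 2 * Re (h \<theta> * cnj (s \<theta>)) + (norm (s \<theta>))\<^sup>2)"
    by (simp add: cmod_power2 power2_diff algebra_simps)
  also have "integral {-pi..pi} \<dots> = integral {-pi..pi} (\<lambda>\<theta>. (norm (h \<theta>))\<^sup>2) - 2 * (2 * pi * A) + 2 * pi * A"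
    by (subst integral_add, (intro integrable_continuous_real continuous_intros)+,
        subst integral_diff, (intro integrable_continuous_real continuous_intros)+,
        subst integral_mult_right, subst hs, subst ss) simp
  finally have "2 * pi * A \<le> integral {-pi..pi} (\<lambda>\<theta>. (norm (h \<theta>))\<^sup>2)" by (simp add: mult_ac)
  then show ?thesis by (simp add: A_def c_def field_simps)
qed

lemma nn_integral_Ioi_le_of_antiderivative:
  fixes g G :: "real \<Rightarrow> real"
  assumes g: "g \<in> borel_measurable borel"
    and G: "\<And>x. x \<ge> 0 \<Longrightarrow> (G has_real_derivative g x) (at x)"
    and nonneg: "\<And>x. x \<ge> 0 \<Longrightarrow> g x \<ge> 0"
    and bound: "\<And>x. x \<ge> 0 \<Longrightarrow> G x - G 0 \<le> A"
  shows "(\<integral>\<^sup>+x\<in>{0<..}. ennreal (g x) \<partial>lborel) \<le> ennreal A"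
proof -
  let ?f = "\<lambda>i x. ennreal (g x) * indicator {0..real i} x"
  have "(\<integral>\<^sup>+x\<in>{0<..}. ennreal (g x) \<partial>lborel) \<le> (\<integral>\<^sup>+x. (SUP i. ?f i x) \<partial>lborel)"
  proof (rule nn_integral_mono)
    fix x :: real
    show "ennreal (g x) * indicator {0<..} x \<le> (SUP i. ?f i x)"
    proof (cases "x > 0")
      case True
      then show ?thesis using real_arch_simple[of x]
        by (auto intro!: SUP_upper2 simp: indicator_def)
    qed auto
  qed
  also have "\<dots> = (SUP i. \<integral>\<^sup>+x. ?f i x \<partial>lborel)"
  proof (rule nn_integral_monotone_convergence_SUP)
    show "incseq ?f" by (auto simp: incseq_def le_fun_def indicator_def)
    show "?f i \<in> borel_measurable lborel" for i using g by measurable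
  qed
  also have "\<dots> \<le> ennreal A"
  proof (rule SUP_least)
    fix i :: nat
    have "(\<integral>\<^sup>+x. ?f i x \<partial>lborel) = ennreal (G (real i) - G 0)"
      using g G nonneg by (intro nn_integral_FTC_Icc) auto
    also have "\<dots> \<le> ennreal A" by (intro ennreal_leI bound) auto
    finally show "(\<integral>\<^sup>+x. ?f i x \<partial>lborel) \<le> ennreal A" .
  qed
  finally show ?thesis .
qed

lemma heat_contour_eq_fourier_coeff:
  "heat_contour S b 0 j t n = integral {-pi..pi} (\<lambda>\<theta>. (exp (of_real t * heat_symbol (Complex 0 \<theta>)) *
     (heat_symbol (Complex 0 \<theta>) ^ j * (\<Sum>m\<in>S. b m * character m \<theta>))) * character (- n) \<theta>) / (2 * pi)"
proof -
  have "exp (of_int (m - n) * Complex 0 \<theta>) = character m \<theta> * character (- n) \<theta>" for m \<theta>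
    using character_add[of m "- n" \<theta>] by (simp add: character_def)
  then show ?thesis
    unfolding heat_contour_def by (simp only: mult.assoc[symmetric] sum_distrib_right[symmetric])
qed

text \<open>Write \<open>a = 2 * (1 - cos \<theta>)\<close>. By Bessel's inequality the sum over \<open>n\<close> is at most the mean over the
  circle of \<open>a\<^sup>2 * exp (- 2 * t * a)\<close> times the squared modulus of the Fourier polynomial of \<open>b\<close>. The weight
  \<open>t\<close> then matters because the integral of \<open>t * a\<^sup>2 * exp (- 2 * t * a)\<close> over \<open>t > 0\<close> is at most \<open>1 / 4\<close>,
  whatever \<open>a \<ge> 0\<close>: an antiderivative is \<open>- (t * a / 2 + 1 / 4) * exp (- 2 * t * a)\<close>.\<close>

lemma heat_contour_square_l2:
  assumes S: "finite S" and F: "finite F"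
  shows "(\<Sum>n\<in>F. \<integral>\<^sup>+t\<in>{0<..}. ennreal (t * (norm (heat_contour S b 0 1 t n))\<^sup>2) \<partial>lborel)
    \<le> ennreal ((\<Sum>m\<in>S. (norm (b m))\<^sup>2) / 4)"
proof -
  define a where "a = (\<lambda>\<theta>::real. 2 * (1 - cos \<theta>))"
  define s where "s = (\<lambda>\<theta>. \<Sum>m\<in>S. b m * character m \<theta>)"
  define P where "P = (\<lambda>\<theta>. (norm (s \<theta>))\<^sup>2)"
  define J where "J = (\<lambda>k t. integral {-pi..pi} (\<lambda>\<theta>. exp (- 2 * t * a \<theta>) * (a \<theta> ^ k * P \<theta>)))"
  have a: "continuous_on A a" "a \<theta> \<ge> 0" for A \<theta> unfolding a_def by (auto intro!: continuous_intros)
  have s: "continuous_on A s" for A unfolding s_def by (intro continuous_intros)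
  have P: "continuous_on A P" "P \<theta> \<ge> 0" for A \<theta> unfolding P_def by (auto intro!: continuous_intros s)
  note [continuous_intros] = a(1) s P(1)
  have J_nonneg: "J k t \<ge> 0" for k t
    unfolding J_def using a P by (intro integral_nonneg integrable_continuous_real continuous_intros) auto
  \<comment> \<open>The differentiation is carried out for a complex-valued copy \<open>Jc\<close> of \<open>J\<close>.\<close>
  have J_deriv: "(J k has_real_derivative (- 2 * J (Suc k) t)) (at t)" for k t
  proof -
    define Jc where "Jc = (\<lambda>k t. integral {-pi..pi} (\<lambda>\<theta>. exp (of_real t * complex_of_real (- 2 * a \<theta>)) * of_real (a \<theta> ^ k * P \<theta>)))"
    have Jc: "Jc k t = complex_of_real (J k t)" for k t
      unfolding J_def Jc_def
      by (subst integral_of_real_continuous[symmetric])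
         (auto intro!: continuous_intros simp: exp_of_real[symmetric] mult_ac)
    have "(Jc k has_vector_derivative integral {-pi..pi} (\<lambda>\<theta>. exp (of_real t * complex_of_real (- 2 * a \<theta>)) *
         (complex_of_real (- 2 * a \<theta>) * of_real (a \<theta> ^ k * P \<theta>)))) (at t)"
      unfolding Jc_def by (rule integral_exp_has_vector_derivative) (intro continuous_intros)+
    also have "integral {-pi..pi} (\<lambda>\<theta>. exp (of_real t * complex_of_real (- 2 * a \<theta>)) *
         (complex_of_real (- 2 * a \<theta>) * of_real (a \<theta> ^ k * P \<theta>))) = - 2 * Jc (Suc k) t"
      unfolding Jc_def integral_mult_right[symmetric] by (simp add: mult_ac)
    finally have "((\<lambda>t. complex_of_real (J k t)) has_vector_derivative complex_of_real (- 2 * J (Suc k) t)) (at t)"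
      unfolding Jc[abs_def] by simp
    from bounded_linear.has_vector_derivative[OF bounded_linear_Re this] show ?thesis
      by (simp add: has_real_derivative_iff_has_vector_derivative)
  qed
  have J_cont: "continuous_on UNIV (J k)" for k
    using J_deriv by (intro continuous_at_imp_continuous_on ballI) (rule DERIV_isCont)
  have bessel: "(\<Sum>n\<in>F. (norm (heat_contour S b 0 1 t n))\<^sup>2) \<le> J 2 t / (2 * pi)" for t
  proof -
    define h where "h = (\<lambda>\<theta>. exp (of_real t * heat_symbol (Complex 0 \<theta>)) * (heat_symbol (Complex 0 \<theta>) ^ 1 * s \<theta>))"
    have hs: "heat_symbol (Complex 0 \<theta>) = - complex_of_real (a \<theta>)" for \<theta>
      by (simp add: heat_symbol_def a_def complex_eq_iff Re_exp Im_exp)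
    have h2: "(norm (h \<theta>))\<^sup>2 = exp (- 2 * t * a \<theta>) * (a \<theta> ^ 2 * P \<theta>)" for \<theta>
      by (simp add: h_def hs norm_mult power_mult_distrib P_def flip: exp_of_nat_mult)
    have "(\<Sum>n\<in>F. (norm (heat_contour S b 0 1 t n))\<^sup>2) =
       (\<Sum>n\<in>F. (norm (integral {-pi..pi} (\<lambda>\<theta>. h \<theta> * character (- n) \<theta>) / (2 * pi)))\<^sup>2)"
      unfolding heat_contour_eq_fourier_coeff h_def s_def ..
    also have "\<dots> \<le> integral {-pi..pi} (\<lambda>\<theta>. (norm (h \<theta>))\<^sup>2) / (2 * pi)"
      by (rule bessel_inequality[OF F]) (unfold h_def, intro continuous_intros)
    also have "\<dots> = J 2 t / (2 * pi)" unfolding h2 J_def ..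
    finally show ?thesis .
  qed
  have "(\<Sum>n\<in>F. \<integral>\<^sup>+t\<in>{0<..}. ennreal (t * (norm (heat_contour S b 0 1 t n))\<^sup>2) \<partial>lborel)
     = (\<integral>\<^sup>+t. (\<Sum>n\<in>F. ennreal (t * (norm (heat_contour S b 0 1 t n))\<^sup>2) * indicator {0<..} t) \<partial>lborel)"
  proof (rule nn_integral_sum[symmetric])
    fix n
    have [measurable]: "(\<lambda>t. heat_contour S b 0 1 t n) \<in> borel_measurable borel"
      by (intro borel_measurable_continuous_onI continuous_on_heat_contour)
    show "(\<lambda>t. ennreal (t * (norm (heat_contour S b 0 1 t n))\<^sup>2) * indicator {0<..} t) \<in> borel_measurable lborel"
      by measurable
  qed
  also have "\<dots> \<le> (\<integral>\<^sup>+t\<in>{0<..}. ennreal (t * J 2 t / (2 * pi)) \<partial>lborel)"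
  proof (rule nn_integral_mono)
    fix t :: real
    show "(\<Sum>n\<in>F. ennreal (t * (norm (heat_contour S b 0 1 t n))\<^sup>2) * indicator {0<..} t)
       \<le> ennreal (t * J 2 t / (2 * pi)) * indicator {0<..} t"
    proof (cases "t > 0")
      case True
      then have "(\<Sum>n\<in>F. ennreal (t * (norm (heat_contour S b 0 1 t n))\<^sup>2))
          = ennreal (t * (\<Sum>n\<in>F. (norm (heat_contour S b 0 1 t n))\<^sup>2))"
        by (simp add: sum_ennreal sum_distrib_left)
      also have "\<dots> \<le> ennreal (t * (J 2 t / (2 * pi)))"
        using True by (intro ennreal_leI mult_left_mono bessel) auto
      finally show ?thesis using True by simp
    qed simp
  qed
  also have "\<dots> \<le> ennreal ((\<Sum>m\<in>S. (norm (b m))\<^sup>2) / 4)"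
  proof (rule nn_integral_Ioi_le_of_antiderivative[where G = "\<lambda>t. - (t * J 1 t / 2 + J 0 t / 4) / (2 * pi)"])
    show "(\<lambda>t. t * J 2 t / (2 * pi)) \<in> borel_measurable borel"
      by (intro borel_measurable_continuous_onI continuous_intros J_cont) simp
    show "((\<lambda>t. - (t * J 1 t / 2 + J 0 t / 4) / (2 * pi)) has_real_derivative t * J 2 t / (2 * pi)) (at t)" for t
      by (auto intro!: derivative_eq_intros J_deriv simp: field_simps numeral_2_eq_2)
    show "t * J 2 t / (2 * pi) \<ge> 0" if "t \<ge> 0" for t using that J_nonneg[of 2 t] by simp
    show "- (t * J 1 t / 2 + J 0 t / 4) / (2 * pi) - - (0 * J 1 0 / 2 + J 0 0 / 4) / (2 * pi) \<le> (\<Sum>m\<in>S. (norm (b m))\<^sup>2) / 4"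
      if "t \<ge> 0" for t
    proof -
      have "(0 * J 1 0 / 2 + J 0 0 / 4) / (2 * pi) = (\<Sum>m\<in>S. (norm (b m))\<^sup>2) / 4"
        using parseval_trig_poly[OF S, of b] by (simp add: J_def P_def s_def)
      moreover have "0 \<le> (t * J 1 t / 2 + J 0 t / 4) / (2 * pi)" using that J_nonneg by simp
      ultimately show ?thesis unfolding minus_divide_left [symmetric] by linarith
    qed
  qed
  finally show ?thesis .
qed

section \<open>The maximal and square functions far from the support\<close>

text \<open>The left-hand side does not mention \<open>\<rho>\<close>. So the contour may be chosen anew
  for every \<open>t\<close> and \<open>n\<close>, even though the square function is an integral in \<open>t\<close>.\<close>

lemma heat_op_vector_derivative:
  assumes "finite S" "{m. b m \<noteq> 0} \<subseteq> S"
  shows "vector_derivative (\<lambda>t. heat_op t b n) (at t) = heat_contour S b \<rho> 1 t n"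
  by (rule vector_derivative_at) (rule heat_op_has_vector_derivative[OF assms])

lemma heat_square_eq:
  assumes "finite S" "{m. b m \<noteq> 0} \<subseteq> S"
  shows "heat_square b n =
    enn_powr (\<integral>\<^sup>+t\<in>{0<..}. ennreal (t * (norm (heat_contour S b 0 1 t n))\<^sup>2) \<partial>lborel) (1 / 2)"
proof -
  have "ennreal ((norm (t *\<^sub>R z))\<^sup>2 / t) * indicator {0<..} t = ennreal (t * (norm z)\<^sup>2) * indicator {0<..} t"
    for t and z :: complex
    by (auto simp: indicator_def power_mult_distrib power2_eq_square)
  then show ?thesis
    unfolding heat_square_def heat_op_vector_derivative[OF assms, of _ _ 0] by simp
qed

text \<open>The integrand is the derivative of \<open>2 * arctan (sqrt (1 + t) / x)\<close>. The estimate expresses that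
  essentially only the times \<open>t\<close> comparable to \<open>x\<^sup>2\<close> contribute at distance \<open>x\<close>.\<close>

lemma nn_integral_heat_scale_lorentz_le:
  assumes "x > 0"
  shows "(\<integral>\<^sup>+t\<in>{0<..}. ennreal ((heat_scale t)\<^sup>2 * (heat_scale t * x / (1 + (heat_scale t * x)\<^sup>2))) \<partial>lborel) \<le> ennreal pi"
proof (rule nn_integral_Ioi_le_of_antiderivative[where G = "\<lambda>t. 2 * arctan (sqrt (1 + t) / x)"])
  show "(\<lambda>t. (heat_scale t)\<^sup>2 * (heat_scale t * x / (1 + (heat_scale t * x)\<^sup>2))) \<in> borel_measurable borel"
    unfolding heat_scale_def by measurable
  fix t :: real assume t: "t \<ge> 0"
  define r where "r = sqrt (1 + t)"
  have r: "r > 0" "1 + t = r\<^sup>2" using t by (auto simp: r_def)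
  have "((\<lambda>t. 2 * arctan (sqrt (1 + t) / x)) has_real_derivative 2 * (inverse (1 + (r / x)\<^sup>2) * (inverse r / 2 / x))) (at t)"
  proof -
    have "(sqrt has_real_derivative inverse r / 2) (at (1 + t))"
      unfolding r_def using t by (intro DERIV_real_sqrt) simp
    then have "((\<lambda>t. sqrt (1 + t)) has_real_derivative inverse r / 2 * 1) (at t)"
      by (rule DERIV_chain2) (auto intro!: derivative_eq_intros)
    from DERIV_cmult[OF DERIV_chain2[OF DERIV_arctan DERIV_cdivide[OF this, of x]], of 2]
    show ?thesis by (simp add: r_def)
  qed
  also have "2 * (inverse (1 + (r / x)\<^sup>2) * (inverse r / 2 / x)) = (heat_scale t)\<^sup>2 * (heat_scale t * x / (1 + (heat_scale t * x)\<^sup>2))"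
    using r(1) assms unfolding heat_scale_def r_def[symmetric]
    by (simp add: divide_simps power2_eq_square)
  finally show "((\<lambda>t. 2 * arctan (sqrt (1 + t) / x)) has_real_derivative
    (heat_scale t)\<^sup>2 * (heat_scale t * x / (1 + (heat_scale t * x)\<^sup>2))) (at t)" .
  show "(heat_scale t)\<^sup>2 * (heat_scale t * x / (1 + (heat_scale t * x)\<^sup>2)) \<ge> 0"
    using heat_scale_pos[OF t] assms
    by (intro mult_nonneg_nonneg divide_nonneg_nonneg add_nonneg_nonneg zero_le_power2) simp_all
  have "arctan (sqrt (1 + 0) / x) > 0" using assms by simp
  with arctan_ubound[of "sqrt (1 + t) / x"]
  show "2 * arctan (sqrt (1 + t) / x) - 2 * arctan (sqrt (1 + 0) / x) \<le> pi" by linarith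
qed

text \<open>With \<open>y = heat_scale t * \<bar>n - n0\<bar>\<close>, the time dependence of the central estimate is
  \<open>y ^ (K + 1) * exp (- y / 2)\<close>, which is bounded.\<close>

lemma heat_op_far_bound:
  obtains C where "C > 0"
    "\<And>t S b n0 n R. t \<ge> 0 \<Longrightarrow> finite S \<Longrightarrow> {m. b m \<noteq> 0} \<subseteq> S \<Longrightarrow> R \<ge> 1 \<Longrightarrow>
       (\<And>m. m \<in> S \<Longrightarrow> real_of_int \<bar>m - n0\<bar> \<le> R) \<Longrightarrow>
       (\<And>k. k < K \<Longrightarrow> (\<Sum>m\<in>S. of_int (m - n0) ^ k * b m) = 0) \<Longrightarrow>
       2 * R \<le> real_of_int \<bar>n - n0\<bar> \<Longrightarrow>
       norm (heat_op t b n) \<le> C * ((\<Sum>m\<in>S. norm (b m)) * R ^ K / real_of_int \<bar>n - n0\<bar> ^ (K + 1))"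
proof -
  obtain C where C: "C > 0"
    "\<And>t S b n0 n R. t \<ge> 0 \<Longrightarrow> finite S \<Longrightarrow> R \<ge> 0 \<Longrightarrow>
       (\<And>m. m \<in> S \<Longrightarrow> real_of_int \<bar>m - n0\<bar> \<le> R) \<Longrightarrow>
       (\<And>k. k < K \<Longrightarrow> (\<Sum>m\<in>S. of_int (m - n0) ^ k * b m) = 0) \<Longrightarrow>
       2 * R \<le> real_of_int \<bar>n - n0\<bar> \<Longrightarrow>
       norm (heat_contour S b (heat_shift (n - n0) t) 0 t n) \<le>
         C * (\<Sum>m\<in>S. norm (b m)) * R ^ K * heat_scale t ^ (K + 2 * 0 + 1)
           * exp (- heat_scale t * real_of_int \<bar>n - n0\<bar> / 2)"
    by (rule heat_contour_far_bound[of K 0]) blast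
  obtain A where A: "A > 0" "\<And>u :: real. u \<ge> 0 \<Longrightarrow> (1 + u) ^ (K + 1) * exp (- (1 / 2) * u) \<le> A"
    by (rule power_times_exp_bounded[of "1 / 2" "K + 1"]) (simp, blast)
  show thesis
  proof (rule that[of "C * A"])
    fix t :: real and S and b :: "int \<Rightarrow> complex" and n0 n :: int and R :: real
    assume t: "t \<ge> 0" and S: "finite S" "{m. b m \<noteq> 0} \<subseteq> S" and R: "R \<ge> 1"
      and supp: "\<And>m. m \<in> S \<Longrightarrow> real_of_int \<bar>m - n0\<bar> \<le> R"
      and mom: "\<And>k. k < K \<Longrightarrow> (\<Sum>m\<in>S. of_int (m - n0) ^ k * b m) = 0"
      and far: "2 * R \<le> real_of_int \<bar>n - n0\<bar>"
    define x where "x = real_of_int \<bar>n - n0\<bar>"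
    define y where "y = heat_scale t * x"
    have x: "x > 0" using R far by (simp add: x_def)
    have y: "y \<ge> 0" using x heat_scale_pos[OF t] by (simp add: y_def)
    define B where "B = (\<Sum>m\<in>S. norm (b m)) * R ^ K"
    have B: "B \<ge> 0" unfolding B_def using R by (intro mult_nonneg_nonneg sum_nonneg) auto
    have "norm (heat_op t b n) \<le> C * B * (heat_scale t ^ (K + 1) * exp (- y / 2))"
      using C(2)[OF t S(1) _ supp mom far] R
      unfolding heat_op_eq_contour[OF S, of t n "heat_shift (n - n0) t"]
      by (simp add: B_def y_def x_def mult_ac)
    also have "heat_scale t ^ (K + 1) = y ^ (K + 1) / x ^ (K + 1)"
      using x by (simp add: y_def power_mult_distrib)
    also have "y ^ (K + 1) / x ^ (K + 1) * exp (- y / 2) = (y ^ (K + 1) * exp (- (1 / 2) * y)) / x ^ (K + 1)"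
      by simp
    also have "C * B * \<dots> \<le> C * B * (A / x ^ (K + 1))"
    proof (intro mult_left_mono divide_right_mono)
      have "y ^ (K + 1) * exp (- (1 / 2) * y) \<le> (1 + y) ^ (K + 1) * exp (- (1 / 2) * y)"
        using y by (intro mult_right_mono power_mono) auto
      then show "y ^ (K + 1) * exp (- (1 / 2) * y) \<le> A" using A(2)[OF y] by linarith
    qed (use C B x in auto)
    finally show "norm (heat_op t b n) \<le> C * A * ((\<Sum>m\<in>S. norm (b m)) * R ^ K / real_of_int \<bar>n - n0\<bar> ^ (K + 1))"
      by (simp add: B_def x_def mult_ac)
  qed (use A C in auto)
qed

text \<open>The extra factor \<open>t * heat_scale t ^ 4\<close> of the squared time derivative is at most
  \<open>(heat_scale t)\<^sup>2\<close>, and what is left of the central estimate is a power of \<open>y = heat_scale t * \<bar>n - n0\<bar>\<close> times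
  \<open>exp (- y)\<close>, hence bounded by a multiple of \<open>y / (1 + y\<^sup>2)\<close>; this reduces the claim to
  \<open>nn_integral_heat_scale_lorentz_le\<close>.\<close>

lemma heat_contour_square_far_bound:
  obtains C where "C > 0"
    "\<And>S b n0 n R. finite S \<Longrightarrow> {m. b m \<noteq> 0} \<subseteq> S \<Longrightarrow> R \<ge> 1 \<Longrightarrow>
       (\<And>m. m \<in> S \<Longrightarrow> real_of_int \<bar>m - n0\<bar> \<le> R) \<Longrightarrow>
       (\<And>k. k < K \<Longrightarrow> (\<Sum>m\<in>S. of_int (m - n0) ^ k * b m) = 0) \<Longrightarrow>
       2 * R \<le> real_of_int \<bar>n - n0\<bar> \<Longrightarrow>
       (\<integral>\<^sup>+t\<in>{0<..}. ennreal (t * (norm (heat_contour S b 0 1 t n))\<^sup>2) \<partial>lborel)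
         \<le> ennreal ((C * ((\<Sum>m\<in>S. norm (b m)) * R ^ K / real_of_int \<bar>n - n0\<bar> ^ (K + 1)))\<^sup>2)"
proof -
  obtain C where C: "C > 0"
    "\<And>t S b n0 n R. t \<ge> 0 \<Longrightarrow> finite S \<Longrightarrow> R \<ge> 0 \<Longrightarrow>
       (\<And>m. m \<in> S \<Longrightarrow> real_of_int \<bar>m - n0\<bar> \<le> R) \<Longrightarrow>
       (\<And>k. k < K \<Longrightarrow> (\<Sum>m\<in>S. of_int (m - n0) ^ k * b m) = 0) \<Longrightarrow>
       2 * R \<le> real_of_int \<bar>n - n0\<bar> \<Longrightarrow>
       norm (heat_contour S b (heat_shift (n - n0) t) 1 t n) \<le>
         C * (\<Sum>m\<in>S. norm (b m)) * R ^ K * heat_scale t ^ (K + 2 * 1 + 1)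
           * exp (- heat_scale t * real_of_int \<bar>n - n0\<bar> / 2)"
    by (rule heat_contour_far_bound[of K 1]) blast
  \<comment> \<open>After splitting off \<open>y\<close>, the power \<open>y ^ (2 * K + 2)\<close> leaves \<open>2 * K + 1\<close> factors; two more give \<open>1 / (1 + y\<^sup>2)\<close>.\<close>
  obtain A where A: "A > 0" "\<And>u :: real. u \<ge> 0 \<Longrightarrow> (1 + u) ^ (2 * K + 3) * exp (- 1 * u) \<le> A"
    by (rule power_times_exp_bounded[of 1 "2 * K + 3"]) (simp, blast)
  show thesis
  proof (rule that[of "C * sqrt (A * pi)"])
    fix S and b :: "int \<Rightarrow> complex" and n0 n :: int and R :: real
    assume S: "finite S" "{m. b m \<noteq> 0} \<subseteq> S" and R: "R \<ge> 1"
      and supp: "\<And>m. m \<in> S \<Longrightarrow> real_of_int \<bar>m - n0\<bar> \<le> R"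
      and mom: "\<And>k. k < K \<Longrightarrow> (\<Sum>m\<in>S. of_int (m - n0) ^ k * b m) = 0"
      and far: "2 * R \<le> real_of_int \<bar>n - n0\<bar>"
    define x where "x = real_of_int \<bar>n - n0\<bar>"
    have x: "x > 0" using R far by (simp add: x_def)
    define B where "B = (\<Sum>m\<in>S. norm (b m)) * R ^ K"
    have B: "B \<ge> 0" unfolding B_def using R by (intro mult_nonneg_nonneg sum_nonneg) auto
    define D where "D = (C * B / x ^ (K + 1))\<^sup>2 * A"
    have D: "D \<ge> 0" using A by (simp add: D_def)
    define g where "g = (\<lambda>t. (heat_scale t)\<^sup>2 * (heat_scale t * x / (1 + (heat_scale t * x)\<^sup>2)))"
    have bound: "t * (norm (heat_contour S b 0 1 t n))\<^sup>2 \<le> D * g t" if t: "t \<ge> 0" for t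
    proof -
      define \<eta> where "\<eta> = heat_scale t"
      define y where "y = \<eta> * x"
      have \<eta>: "\<eta> > 0" "t * \<eta>\<^sup>2 \<le> 1"
        using t by (auto simp: \<eta>_def heat_scale_pos heat_scale_square_le)
      have y: "y > 0" using x \<eta> by (simp add: y_def)
      have "heat_contour S b 0 1 t n = heat_contour S b (heat_shift (n - n0) t) 1 t n"
        using heat_op_vector_derivative[OF S] by metis
      then have "norm (heat_contour S b 0 1 t n) \<le> C * B * \<eta> ^ (K + 3) * exp (- y / 2)"
        using C(2)[OF t S(1) _ supp mom far] R
        by (simp add: B_def y_def x_def \<eta>_def eval_nat_numeral mult_ac)
      then have "(norm (heat_contour S b 0 1 t n))\<^sup>2 \<le> (C * B * \<eta> ^ (K + 3) * exp (- y / 2))\<^sup>2"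
        by (intro power_mono) auto
      then have "t * (norm (heat_contour S b 0 1 t n))\<^sup>2 \<le> t * (C * B * \<eta> ^ (K + 3) * exp (- y / 2))\<^sup>2"
        using t by (rule mult_left_mono)
      also have "\<dots> = (C * B)\<^sup>2 * (t * \<eta>\<^sup>2) * \<eta>\<^sup>2 * ((\<eta> ^ (K + 1))\<^sup>2 * exp (- 1 * y))"
        by (simp add: power_mult_distrib power_add power2_eq_square eval_nat_numeral mult_ac flip: exp_add)
      also have "\<eta> ^ (K + 1) = y ^ (K + 1) / x ^ (K + 1)"
        using x by (simp add: y_def power_mult_distrib)
      also have "(C * B)\<^sup>2 * (t * \<eta>\<^sup>2) * \<eta>\<^sup>2 * ((y ^ (K + 1) / x ^ (K + 1))\<^sup>2 * exp (- 1 * y))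
          = (C * B / x ^ (K + 1))\<^sup>2 * \<eta>\<^sup>2 * (t * \<eta>\<^sup>2) * ((y ^ (K + 1))\<^sup>2 * exp (- 1 * y))"
        by (simp add: power_divide mult_ac)
      also have "\<dots> \<le> (C * B / x ^ (K + 1))\<^sup>2 * \<eta>\<^sup>2 * 1 * (A * y / (1 + y\<^sup>2))"
      proof (intro mult_mono order_refl \<eta>)
        have "(y ^ (K + 1))\<^sup>2 * exp (- 1 * y) * (1 + y\<^sup>2) = y * (y ^ (2 * K + 1) * (1 + y\<^sup>2) * exp (- 1 * y))"
          by (simp add: power_mult_distrib power_mult power2_eq_square mult_ac)
        also have "\<dots> \<le> y * ((1 + y) ^ (2 * K + 1) * (1 + y)\<^sup>2 * exp (- 1 * y))"
          using y by (intro mult_left_mono mult_right_mono mult_mono power_mono)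
            (auto simp: power2_eq_square algebra_simps)
        also have "(1 + y) ^ (2 * K + 1) * (1 + y)\<^sup>2 = (1 + y) ^ (2 * K + 3)"
          by (simp flip: power_add add: eval_nat_numeral)
        also have "y * ((1 + y) ^ (2 * K + 3) * exp (- 1 * y)) \<le> y * A"
          using y by (intro mult_left_mono A) auto
        finally show "(y ^ (K + 1))\<^sup>2 * exp (- 1 * y) \<le> A * y / (1 + y\<^sup>2)"
          by (subst pos_le_divide_eq) (auto intro: add_pos_nonneg simp: mult_ac)
      qed (use t \<eta> in auto)
      also have "\<dots> = D * g t" by (simp add: D_def g_def y_def \<eta>_def)
      finally show ?thesis .
    qed
    have "(\<integral>\<^sup>+t\<in>{0<..}. ennreal (t * (norm (heat_contour S b 0 1 t n))\<^sup>2) \<partial>lborel)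
       \<le> (\<integral>\<^sup>+t. ennreal D * (ennreal (g t) * indicator {0<..} t) \<partial>lborel)"
      using bound D by (intro nn_integral_mono)
        (auto simp: indicator_def ennreal_mult'[symmetric] intro!: ennreal_leI)
    also have "\<dots> = ennreal D * (\<integral>\<^sup>+t\<in>{0<..}. ennreal (g t) \<partial>lborel)"
      by (rule nn_integral_cmult) (unfold g_def heat_scale_def, measurable)
    also have "\<dots> \<le> ennreal D * ennreal pi"
      unfolding g_def by (intro mult_left_mono nn_integral_heat_scale_lorentz_le x) auto
    also have "\<dots> = ennreal ((C * sqrt (A * pi) * (B / x ^ (K + 1)))\<^sup>2)"
      using A D by (simp add: D_def power_mult_distrib power_divide ennreal_mult'[symmetric] mult_ac)
    finally show "(\<integral>\<^sup>+t\<in>{0<..}. ennreal (t * (norm (heat_contour S b 0 1 t n))\<^sup>2) \<partial>lborel)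
       \<le> ennreal ((C * sqrt (A * pi) * ((\<Sum>m\<in>S. norm (b m)) * R ^ K / real_of_int \<bar>n - n0\<bar> ^ (K + 1)))\<^sup>2)"
      unfolding B_def x_def .
  qed (use A C in auto)
qed

section \<open>Quasinorms and countable sums\<close>

lemma enn_powr_ennreal: "x \<ge> 0 \<Longrightarrow> enn_powr (ennreal x) q = ennreal (x powr q)"
  by (simp add: enn_powr_def)

lemma enn_powr_top [simp]: "enn_powr top q = top"
  by (simp add: enn_powr_def)

lemma enn_powr_mono:
  assumes "x \<le> y" "q \<ge> 0"
  shows "enn_powr x q \<le> enn_powr y q"
  using assms by (cases x; cases y) (auto simp: enn_powr_ennreal powr_mono2 top_unique intro!: ennreal_leI)

lemma enn_powr_1 [simp]: "enn_powr x 1 = x"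
  by (cases x) (auto simp: enn_powr_ennreal)

lemma enn_powr_cmult:
  assumes "c \<ge> 0"
  shows "enn_powr (ennreal c * x) q = ennreal (c powr q) * enn_powr x q"
proof (cases x)
  case (real r)
  then show ?thesis using assms by (simp add: enn_powr_ennreal powr_mult flip: ennreal_mult')
next
  case top
  then show ?thesis using assms
    by (cases "c = 0") (auto simp: enn_powr_ennreal[of 0, simplified] ennreal_mult_top)
qed

lemma enn_powr_square_half [simp]: "enn_powr (x\<^sup>2) (1 / 2) = x"
  by (cases x) (auto simp: enn_powr_ennreal powr_half_sqrt ennreal_power)

lemma enn_powr_half_square [simp]: "(enn_powr x (1 / 2))\<^sup>2 = x"
  by (cases x) (auto simp: enn_powr_ennreal powr_half_sqrt ennreal_power)

lemma enn_powr_le_one_plus_square: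
  assumes "0 < p" "p \<le> 1"
  shows "enn_powr x p \<le> 1 + x\<^sup>2"
proof (cases x)
  case (real r)
  have "r powr p \<le> 1 + r\<^sup>2"
  proof (cases "r \<le> 1")
    case True
    then have "r powr p \<le> 1" using powr_mono2[of p r 1] real assms by simp
    then show ?thesis by (smt (verit) zero_le_power2)
  next
    case False
    then have "r powr p \<le> r powr 2" using assms by (intro powr_mono) auto
    with False show ?thesis by simp
  qed
  then have "ennreal (r powr p) \<le> ennreal (1 + r\<^sup>2)" by (rule ennreal_leI)
  then show ?thesis using real by (simp add: enn_powr_ennreal ennreal_plus ennreal_power)
qed simp

text \<open>Every term satisfies \<open>x j powr p \<le> s\<close> for the sum \<open>s\<close> of the \<open>p\<close>-th powers, so
  \<open>x j = x j powr p * (x j powr p) powr (1 / p - 1) \<le> x j powr p * s powr (1 / p - 1)\<close>.\<close>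

lemma suminf_powr_le:
  fixes x :: "nat \<Rightarrow> real"
  assumes p: "0 < p" "p \<le> 1" and x: "\<And>j. x j \<ge> 0" and sum: "summable (\<lambda>j. x j powr p)"
  shows "summable x" "(\<Sum>j. x j) \<le> (\<Sum>j. x j powr p) powr (1 / p)"
proof -
  define s where "s = (\<Sum>j. x j powr p)"
  have s: "s \<ge> 0" unfolding s_def by (intro suminf_nonneg sum) auto
  have le: "x j \<le> x j powr p * s powr (1 / p - 1)" for j
  proof -
    have "x j powr p \<le> s" unfolding s_def using sum_le_suminf[OF sum, of "{j}"] by simp
    then have "(x j powr p) powr (1 / p - 1) \<le> s powr (1 / p - 1)"
      using p by (intro powr_mono2) auto
    then have "x j powr p * (x j powr p) powr (1 / p - 1) \<le> x j powr p * s powr (1 / p - 1)"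
      by (intro mult_left_mono) auto
    moreover have "x j powr p * (x j powr p) powr (1 / p - 1) = x j"
      using x[of j] p by (cases "x j = 0") (auto simp: powr_powr algebra_simps simp flip: powr_add)
    ultimately show ?thesis by simp
  qed
  have sum': "summable (\<lambda>j. x j powr p * s powr (1 / p - 1))" by (intro summable_mult2 sum)
  show sx: "summable x"
    by (rule summable_comparison_test'[OF sum', of 0]) (use le x in auto)
  have "(\<Sum>j. x j) \<le> (\<Sum>j. x j powr p * s powr (1 / p - 1))"
    by (intro suminf_le le sx sum')
  also have "\<dots> = s * s powr (1 / p - 1)"
    unfolding s_def by (intro suminf_mult2[symmetric] sum)
  also have "\<dots> = s powr (1 / p)"
    using s by (cases "s = 0") (auto simp: powr_diff)
  finally show "(\<Sum>j. x j) \<le> (\<Sum>j. x j powr p) powr (1 / p)" unfolding s_def .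
qed

lemma enn_powr_suminf_le:
  assumes p: "0 < p" "p \<le> 1"
  shows "enn_powr (\<Sum>j. a j) p \<le> (\<Sum>j. enn_powr (a j) p)"
proof (cases "(\<Sum>j. enn_powr (a j) p) = top")
  case False
  have fin: "enn_powr (a j) p \<noteq> top" for j
    using False ennreal_suminf_lessD[of "\<lambda>j. enn_powr (a j) p" top j] by (simp add: less_top)
  define x where "x = (\<lambda>j. enn2real (a j))"
  have a: "a j = ennreal (x j)" for j
    using fin[of j] by (cases "a j") (auto simp: x_def)
  have x: "x j \<ge> 0" for j by (simp add: x_def)
  have eq: "enn_powr (a j) p = ennreal (x j powr p)" for j by (simp add: a enn_powr_ennreal x)
  have sum: "summable (\<lambda>j. x j powr p)"
    using False by (intro summable_suminf_not_top) (auto simp: eq)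
  have "(\<Sum>j. a j) = ennreal (\<Sum>j. x j)"
    unfolding a using suminf_powr_le(1)[OF p x sum] by (intro suminf_ennreal2 x)
  then have "enn_powr (\<Sum>j. a j) p = ennreal ((\<Sum>j. x j) powr p)"
    using suminf_nonneg[OF suminf_powr_le(1)[OF p x sum]] x by (simp add: enn_powr_ennreal)
  also have "\<dots> \<le> ennreal (((\<Sum>j. x j powr p) powr (1 / p)) powr p)"
    using p suminf_powr_le[OF p x sum] x
    by (intro ennreal_leI powr_mono2) (auto intro: suminf_nonneg)
  also have "\<dots> = (\<Sum>j. enn_powr (a j) p)"
    using p suminf_nonneg[OF sum] unfolding eq by (simp add: powr_powr suminf_ennreal2[OF _ sum])
  finally show ?thesis .
qed simp

lemma nn_integral_count_space_int_le:
  fixes f :: "int \<Rightarrow> ennreal"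
  assumes "\<And>F. finite F \<Longrightarrow> (\<Sum>n\<in>F. f n) \<le> C"
  shows "(\<integral>\<^sup>+n. f n \<partial>count_space UNIV) \<le> C"
proof -
  have "(\<integral>\<^sup>+n. f n \<partial>count_space UNIV) = (\<integral>\<^sup>+i. f (int_decode i) \<partial>count_space UNIV)"
    by (intro nn_integral_bij_count_space[symmetric]) (auto simp: bij_int_decode)
  also have "\<dots> = (\<Sum>i. f (int_decode i))" by (rule nn_integral_count_space_nat)
  also have "\<dots> \<le> C"
  proof (rule suminf_le_const)
    fix N
    have "(\<Sum>i<N. f (int_decode i)) = (\<Sum>n\<in>int_decode ` {..<N}. f n)"
      by (subst sum.reindex) (auto simp: inj_int_decode)
    also have "\<dots> \<le> C" by (intro assms) auto
    finally show "(\<Sum>i<N. f (int_decode i)) \<le> C" .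
  qed simp
  finally show ?thesis .
qed

lemma ennreal_norm_sums_le:
  fixes a :: "nat \<Rightarrow> 'a::banach"
  assumes "a sums s"
  shows "ennreal (norm s) \<le> (\<Sum>j. ennreal (norm (a j)))"
proof (cases "(\<Sum>j. ennreal (norm (a j))) = top")
  case False
  then have sum: "summable (\<lambda>j. norm (a j))" by (intro summable_suminf_not_top) auto
  have "norm s \<le> (\<Sum>j. norm (a j))"
    using summable_norm[OF sum] assms by (simp add: sums_iff)
  then show ?thesis by (subst suminf_ennreal2[OF _ sum]) (auto intro: ennreal_leI)
qed simp

text \<open>Expand the square into a double series, integrate termwise and apply the Cauchy--Schwarz inequality
  to every product.\<close>

lemma nn_integral_Minkowski_suminf:
  fixes u :: "nat \<Rightarrow> 'a \<Rightarrow> ennreal"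
  assumes [measurable]: "\<And>j. u j \<in> borel_measurable M"
  shows "enn_powr (\<integral>\<^sup>+x. (\<Sum>j. u j x)\<^sup>2 \<partial>M) (1 / 2) \<le> (\<Sum>j. enn_powr (\<integral>\<^sup>+x. (u j x)\<^sup>2 \<partial>M) (1 / 2))"
proof -
  define N where "N = (\<lambda>j. enn_powr (\<integral>\<^sup>+x. (u j x)\<^sup>2 \<partial>M) (1 / 2))"
  have cs: "(\<integral>\<^sup>+x. u i x * u j x \<partial>M) \<le> N i * N j" for i j
  proof -
    have "(\<integral>\<^sup>+x. u i x * u j x \<partial>M)\<^sup>2 \<le> (N i * N j)\<^sup>2"
      unfolding power_mult_distrib N_def enn_powr_half_square by (rule Cauchy_Schwarz_nn_integral) auto
    from enn_powr_mono[OF this, of "1 / 2"] show ?thesis by simp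
  qed
  have "(\<integral>\<^sup>+x. (\<Sum>j. u j x)\<^sup>2 \<partial>M) = (\<integral>\<^sup>+x. (\<Sum>i. \<Sum>j. u i x * u j x) \<partial>M)"
    by (simp add: power2_eq_square)
  also have "\<dots> = (\<Sum>i. \<Sum>j. \<integral>\<^sup>+x. u i x * u j x \<partial>M)"
    by (simp only: nn_integral_suminf borel_measurable_suminf_order borel_measurable_times_ennreal assms)
  also have "\<dots> \<le> (\<Sum>i. \<Sum>j. N i * N j)" by (intro suminf_le cs) auto
  also have "\<dots> = (\<Sum>j. N j)\<^sup>2" by (simp add: power2_eq_square)
  finally have "enn_powr (\<integral>\<^sup>+x. (\<Sum>j. u j x)\<^sup>2 \<partial>M) (1 / 2) \<le> enn_powr ((\<Sum>j. N j)\<^sup>2) (1 / 2)"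
    by (rule enn_powr_mono) simp
  then show ?thesis by (simp add: N_def)
qed

section \<open>From local and far bounds to the quasinorm\<close>

text \<open>Compare each term with a difference of consecutive values of an antiderivative and
  telescope. The lower limit \<open>2 * R\<close> instead of \<open>R\<close> leaves room for the shift by one.\<close>

lemma powr_tail_sum_le:
  fixes s R :: real
  assumes s: "s > 1" and R: "R \<ge> 1" and I: "finite I" "\<And>i. i \<in> I \<Longrightarrow> 2 * R \<le> real i"
  shows "(\<Sum>i\<in>I. real i powr (- s)) \<le> R powr (1 - s) / (s - 1)"
proof -
  define v where "v = (\<lambda>x::real. x powr (1 - s) / (s - 1))"
  have step: "real (Suc i) powr (- s) \<le> v (real i) - v (real (Suc i))" if "real i > 0" for i
  proof -
    have "\<exists>z. real i < z \<and> z < real (Suc i) \<and>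
      - v (real (Suc i)) - - v (real i) = (real (Suc i) - real i) * (z powr (- s))"
    proof (rule MVT2)
      fix x assume "real i \<le> x"
      then have "x > 0" using that by simp
      then show "((\<lambda>x. - v x) has_real_derivative x powr (- s)) (at x)"
      proof -
        have "(1 - s) * x powr (- s) / (s - 1) = - (x powr (- s))"
          using s by (simp add: divide_eq_eq algebra_simps)
        then show ?thesis
          using DERIV_minus[OF DERIV_cdivide[OF has_real_derivative_powr[OF \<open>x > 0\<close>, of "1 - s"], of "s - 1"]]
          by (simp add: v_def)
      qed
    qed simp
    then obtain z where z: "real i < z" "z < real (Suc i)" "v (real i) - v (real (Suc i)) = z powr (- s)"
      by auto
    have "real (Suc i) powr (- s) \<le> z powr (- s)"
      using z s that by (intro powr_mono2') auto
    with z show ?thesis by simp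
  qed
  define a where "a = nat \<lceil>R\<rceil>"
  have a: "R \<le> real a" "a \<ge> 1" using R by (auto simp: a_def) linarith
  define N where "N = Suc (Max (insert a I))"
  have N: "\<forall>i\<in>I. i < N" "a < N" using I(1) by (auto simp: N_def less_Suc_eq_le)
  have v_nonneg: "v x \<ge> 0" for x using s by (simp add: v_def)
  have aI: "Suc a \<le> i" if "i \<in> I" for i
  proof -
    have "real a < R + 1" using R by (simp add: a_def) linarith
    then have "real a < real i" using I(2)[OF that] R by linarith
    then show ?thesis by simp
  qed
  have "(\<Sum>i\<in>I. real i powr (- s)) \<le> (\<Sum>i\<in>{Suc a..<Suc N}. real i powr (- s))"
    using aI N I by (intro sum_mono2) fastforce+
  also have "\<dots> = (\<Sum>i\<in>{a..<N}. real (Suc i) powr (- s))"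
    by (rule sum.shift_bounds_Suc_ivl)
  also have "\<dots> \<le> (\<Sum>i\<in>{a..<N}. v (real i) - v (real (Suc i)))"
    using a by (intro sum_mono step) auto
  also have "\<dots> = v (real a) - v (real N)"
    using N sum_Suc_diff'[of a N "\<lambda>i. - v (real i)"] by (simp add: algebra_simps)
  also have "\<dots> \<le> v R"
  proof -
    have "real a powr (1 - s) \<le> R powr (1 - s)" using a R s by (intro powr_mono2') auto
    then have "v (real a) \<le> v R" using s by (simp add: v_def divide_right_mono)
    with v_nonneg[of "real N"] show ?thesis by linarith
  qed
  finally show ?thesis by (simp add: v_def)
qed

lemma int_ball_subset:
  fixes n0 :: int
  shows "{n. real_of_int \<bar>n - n0\<bar> < r} \<subseteq> {n0 - \<lfloor>r\<rfloor>..n0 + \<lfloor>r\<rfloor>}"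
proof
  fix n assume "n \<in> {n. real_of_int \<bar>n - n0\<bar> < r}"
  then have "\<bar>n - n0\<bar> \<le> \<lfloor>r\<rfloor>" by (simp only: le_floor_iff mem_Collect_eq less_imp_le)
  then show "n \<in> {n0 - \<lfloor>r\<rfloor>..n0 + \<lfloor>r\<rfloor>}" by auto
qed

lemma finite_int_ball: "finite {n. real_of_int \<bar>n - n0\<bar> < r}"
  by (rule finite_subset[OF int_ball_subset]) simp

lemma card_int_ball_le:
  assumes "R \<ge> 1"
  shows "real (card {n. real_of_int \<bar>n - n0\<bar> < 2 * R}) \<le> 5 * R"
proof -
  have "card {n. real_of_int \<bar>n - n0\<bar> < 2 * R} \<le> card {n0 - \<lfloor>2 * R\<rfloor>..n0 + \<lfloor>2 * R\<rfloor>}"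
    by (intro card_mono int_ball_subset) auto
  also have "\<dots> = nat (2 * \<lfloor>2 * R\<rfloor> + 1)" by simp
  finally have "real (card {n. real_of_int \<bar>n - n0\<bar> < 2 * R}) \<le> real (nat (2 * \<lfloor>2 * R\<rfloor> + 1))"
    by (simp only: of_nat_le_iff)
  also have "\<dots> \<le> 5 * R" using assms by linarith
  finally show ?thesis .
qed

text \<open>The shape shared by the maximal and the square function of an atom on a ball of radius \<open>R\<close>.
  Near the ball a bound in the mean square suffices: \<open>y powr p \<le> 1 + y\<^sup>2\<close> is applied to
  \<open>y = R powr (1 / p) * F n\<close> at each of the at most \<open>5 * R\<close> points. Away from the ball the
  \<open>p\<close>-th powers are summable because \<open>p * (K + 1) > 1\<close>, and all powers of \<open>R\<close> cancel.\<close>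

lemma lp_bound_of_local_far:
  fixes p A :: real and K :: nat
  assumes p: "0 < p" "p \<le> 1" and K: "p * real (K + 1) > 1" and A: "A \<ge> 0"
  obtains C where "C > 0" "\<And>F n0 R. R \<ge> 1 \<Longrightarrow>
     (\<Sum>n\<in>{n. real_of_int \<bar>n - n0\<bar> < 2 * R}. (F n)\<^sup>2) \<le> ennreal (A * R powr (1 - 2 / p)) \<Longrightarrow>
     (\<And>n. 2 * R \<le> real_of_int \<bar>n - n0\<bar> \<Longrightarrow>
        F n \<le> ennreal (A * R powr (real (K + 1) - 1 / p) / real_of_int \<bar>n - n0\<bar> ^ (K + 1))) \<Longrightarrow>
     (\<integral>\<^sup>+n. enn_powr (F n) p \<partial>count_space UNIV) \<le> ennreal C"
proof -
  define s where "s = p * real (K + 1)"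
  have s: "s > 1" using K by (simp add: s_def)
  define C where "C = 5 + A + A powr p * (2 / (s - 1))"
  have "C > 0" using A s by (auto simp: C_def intro!: add_pos_nonneg)
  show thesis
  proof (rule that[OF \<open>C > 0\<close>])
    fix F :: "int \<Rightarrow> ennreal" and n0 :: int and R :: real
    assume R: "R \<ge> 1"
      and loc: "(\<Sum>n\<in>{n. real_of_int \<bar>n - n0\<bar> < 2 * R}. (F n)\<^sup>2) \<le> ennreal (A * R powr (1 - 2 / p))"
      and far: "\<And>n. 2 * R \<le> real_of_int \<bar>n - n0\<bar> \<Longrightarrow>
        F n \<le> ennreal (A * R powr (real (K + 1) - 1 / p) / real_of_int \<bar>n - n0\<bar> ^ (K + 1))"
    define G where "G = {n. real_of_int \<bar>n - n0\<bar> < 2 * R}"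
    have G: "finite G" unfolding G_def by (rule finite_int_ball)
    have cardG: "real (card G) \<le> 5 * R" unfolding G_def by (rule card_int_ball_le[OF R])
    have local_sum: "(\<Sum>n\<in>G. enn_powr (F n) p) \<le> ennreal (5 + A)"
    proof -
      define c where "c = R powr (1 / p)"
      have c: "c > 0" "c powr p = R" "c\<^sup>2 = R powr (2 / p)"
        using R p by (auto simp: c_def powr_powr simp flip: powr_add powr_realpow)
      have "enn_powr (F n) p \<le> ennreal (1 / R) * (1 + ennreal (c\<^sup>2) * (F n)\<^sup>2)" for n
      proof -
        have "enn_powr (F n) p = ennreal (1 / R) * (ennreal (c powr p) * enn_powr (F n) p)"
          using R by (simp add: c mult.assoc[symmetric] flip: ennreal_mult')
        also have "\<dots> = ennreal (1 / R) * enn_powr (ennreal c * F n) p"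
          using c by (simp add: enn_powr_cmult)
        also have "\<dots> \<le> ennreal (1 / R) * (1 + (ennreal c * F n)\<^sup>2)"
          by (intro mult_left_mono enn_powr_le_one_plus_square p) auto
        finally show ?thesis using c by (simp add: power_mult_distrib ennreal_power)
      qed
      then have "(\<Sum>n\<in>G. enn_powr (F n) p) \<le> (\<Sum>n\<in>G. ennreal (1 / R) * (1 + ennreal (c\<^sup>2) * (F n)\<^sup>2))"
        by (rule sum_mono)
      also have "\<dots> = ennreal (1 / R) * (of_nat (card G) + ennreal (c\<^sup>2) * (\<Sum>n\<in>G. (F n)\<^sup>2))"
        by (simp add: sum.distrib flip: sum_distrib_left)
      also have "\<dots> \<le> ennreal (1 / R) * (ennreal (5 * R) + ennreal (c\<^sup>2) * ennreal (A * R powr (1 - 2 / p)))"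
        using cardG loc unfolding G_def[symmetric]
        by (intro mult_left_mono add_mono) (auto simp: ennreal_of_nat_eq_real_of_nat intro!: ennreal_leI)
      also have "\<dots> = ennreal (1 / R * (5 * R + c\<^sup>2 * (A * R powr (1 - 2 / p))))"
      proof -
        have "ennreal a * (ennreal x + ennreal y * ennreal z) = ennreal (a * (x + y * z))"
          if "a \<ge> 0" "x \<ge> 0" "y \<ge> 0" "z \<ge> 0" for a x y z
          using that by (simp add: ennreal_mult ennreal_plus)
        from this[of "1 / R" "5 * R" "c\<^sup>2" "A * R powr (1 - 2 / p)"] show ?thesis
          using R A by (simp only: zero_le_power2 powr_ge_zero zero_le_mult_iff zero_le_divide_1_iff) auto
      qed
      also have "c\<^sup>2 * (A * R powr (1 - 2 / p)) = A * R"
        using R by (simp add: c powr_diff)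
      also have "1 / R * (5 * R + A * R) = 5 + A" using R by (simp add: field_simps)
      finally show ?thesis .
    qed
    show "(\<integral>\<^sup>+n. enn_powr (F n) p \<partial>count_space UNIV) \<le> ennreal C"
    proof (rule nn_integral_count_space_int_le)
      fix H :: "int set" assume H: "finite H"
      have "(\<Sum>n\<in>H - G. enn_powr (F n) p) \<le> ennreal (A powr p * (2 / (s - 1)))"
      proof -
        \<comment> \<open>The \<open>p\<close>-th power of the far bound is \<open>D * \<bar>n - n0\<bar> powr (- s)\<close>.\<close>
        define D where "D = A powr p * R powr (s - 1)"
        have "enn_powr (F n) p \<le> ennreal (D * real (nat \<bar>n - n0\<bar>) powr (- s))" if "n \<in> H - G" for n
        proof -
          define x where "x = real_of_int \<bar>n - n0\<bar>"
          have x: "2 * R \<le> x" "x > 0" using that R by (auto simp: G_def x_def)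
          have "enn_powr (F n) p \<le> enn_powr (ennreal (A * R powr (real (K + 1) - 1 / p) / x ^ (K + 1))) p"
            using far[of n] x p unfolding x_def by (intro enn_powr_mono) auto
          also have "\<dots> = ennreal ((A * R powr (real (K + 1) - 1 / p) / x ^ (K + 1)) powr p)"
            using A x by (intro enn_powr_ennreal) auto
          also have "(A * R powr (real (K + 1) - 1 / p) / x ^ (K + 1)) powr p
              = A powr p * R powr ((real (K + 1) - 1 / p) * p) / x powr (real (K + 1) * p)"
            using A x unfolding powr_realpow[OF x(2), symmetric]
            by (simp only: powr_divide powr_mult powr_powr powr_ge_zero mult_nonneg_nonneg)
          also have "(real (K + 1) - 1 / p) * p = s - 1" using p by (simp add: s_def algebra_simps)
          also have "real (K + 1) * p = s" by (simp add: s_def)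
          also have "A powr p * R powr (s - 1) / x powr s = D * real (nat \<bar>n - n0\<bar>) powr (- s)"
            by (simp add: D_def x_def powr_minus divide_inverse)
          finally show ?thesis .
        qed
        then have "(\<Sum>n\<in>H - G. enn_powr (F n) p) \<le> (\<Sum>n\<in>H - G. ennreal (D * real (nat \<bar>n - n0\<bar>) powr (- s)))"
          by (rule sum_mono)
        also have "\<dots> = ennreal (D * (\<Sum>n\<in>H - G. real (nat \<bar>n - n0\<bar>) powr (- s)))"
          by (subst sum_ennreal) (auto simp: D_def sum_distrib_left)
        also have "\<dots> \<le> ennreal (D * (2 * (R powr (1 - s) / (s - 1))))"
        proof (intro ennreal_leI mult_left_mono)
          have "(\<Sum>n\<in>H - G. real (nat \<bar>n - n0\<bar>) powr (- s))
              \<le> 2 * (\<Sum>i\<in>(\<lambda>n. nat \<bar>n - n0\<bar>) ` (H - G). real i powr (- s))"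
            using H by (intro sum_int_le_sum_nat) auto
          also have "\<dots> \<le> 2 * (R powr (1 - s) / (s - 1))"
            using H s R by (intro mult_left_mono powr_tail_sum_le) (auto simp: G_def)
          finally show "(\<Sum>n\<in>H - G. real (nat \<bar>n - n0\<bar>) powr (- s)) \<le> 2 * (R powr (1 - s) / (s - 1))" .
        qed (simp add: D_def)
        also have "D * (2 * (R powr (1 - s) / (s - 1))) = A powr p * (2 / (s - 1))"
        proof -
          have "R powr (s - 1) * R powr (1 - s) = 1" using R by (simp flip: powr_add)
          then show ?thesis by (simp add: D_def)
        qed
        finally show ?thesis .
      qed
      moreover have "(\<Sum>n\<in>H \<inter> G. enn_powr (F n) p) \<le> ennreal (5 + A)"
        using local_sum G by (intro order_trans[OF sum_mono2 local_sum]) auto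
      ultimately have "(\<Sum>n\<in>H \<inter> G. enn_powr (F n) p) + (\<Sum>n\<in>H - G. enn_powr (F n) p)
          \<le> ennreal (5 + A) + ennreal (A powr p * (2 / (s - 1)))"
        by (intro add_mono)
      also have "\<dots> = ennreal C" using A s by (simp add: C_def flip: ennreal_plus)
      finally show "(\<Sum>n\<in>H. enn_powr (F n) p) \<le> ennreal C"
        by (simp add: sum.Int_Diff[OF H, of _ G])
    qed
  qed
qed

section \<open>Uniform bounds on atoms\<close>

text \<open>An atom has \<open>nat \<lfloor>1 / p\<rfloor>\<close> vanishing moments (\<open>k \<le> 1 / p - 1\<close> means \<open>k < \<lfloor>1 / p\<rfloor>\<close>), just enough
  for the far bound to have summable \<open>p\<close>-th powers.\<close>

lemma moment_count_gt:
  assumes "0 < p"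
  shows "p * real (nat \<lfloor>1 / p\<rfloor> + 1) > 1"
proof -
  have "real (nat \<lfloor>1 / p\<rfloor> + 1) = of_int \<lfloor>1 / p\<rfloor> + 1" using assms by simp
  moreover have "1 / p < of_int \<lfloor>1 / p\<rfloor> + 1" by (rule floor_correct[THEN conjunct2, simplified])
  ultimately have "1 / p < real (nat \<lfloor>1 / p\<rfloor> + 1)" by linarith
  from mult_strict_left_mono[OF this assms] show ?thesis using assms by simp
qed

lemma translated_moment_eq_0:
  fixes b :: "int \<Rightarrow> complex"
  assumes "\<And>i. i \<le> k \<Longrightarrow> (\<Sum>m\<in>S. of_int m ^ i * b m) = 0"
  shows "(\<Sum>m\<in>S. of_int (m - n0) ^ k * b m) = 0"
proof -
  have "(\<Sum>m\<in>S. of_int (m - n0) ^ k * b m)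
     = (\<Sum>m\<in>S. \<Sum>i\<le>k. (of_nat (k choose i) * (- of_int n0) ^ (k - i)) * (of_int m ^ i * b m))"
  proof (rule sum.cong)
    fix m
    have "(of_int (m - n0) :: complex) ^ k = (of_int m + (- of_int n0)) ^ k" by simp
    also have "\<dots> = (\<Sum>i\<le>k. of_nat (k choose i) * of_int m ^ i * (- of_int n0) ^ (k - i))"
      by (rule binomial_ring)
    finally show "of_int (m - n0) ^ k * b m =
        (\<Sum>i\<le>k. (of_nat (k choose i) * (- of_int n0) ^ (k - i)) * (of_int m ^ i * b m))"
      by (simp only: sum_distrib_left sum_distrib_right mult_ac)
  qed simp
  also have "\<dots> = (\<Sum>i\<le>k. (of_nat (k choose i) * (- of_int n0) ^ (k - i)) * (\<Sum>m\<in>S. of_int m ^ i * b m))"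
    by (subst sum.swap) (simp add: sum_distrib_left)
  also have "\<dots> = 0" using assms by simp
  finally show ?thesis .
qed

text \<open>The radius is rounded up to an integer \<open>R\<close>. The ball then has \<open>2 * R - 1\<close> points, and
  \<open>R \<le> 2 * R - 1 \<le> 2 * R\<close> allows measuring it by \<open>R\<close>. The moments are moved to the centre of the ball.\<close>

lemma hardy_atomE:
  assumes p: "0 < p" "p \<le> 1" and "hardy_atom p b"
  obtains n0 :: int and R :: real and S where
    "R \<ge> 1" "finite S" "{m. b m \<noteq> 0} \<subseteq> S" "\<And>m. m \<in> S \<Longrightarrow> real_of_int \<bar>m - n0\<bar> \<le> R"
    "real (card S) \<le> 2 * R" "\<And>m. norm (b m) \<le> R powr (- 1 / p)"
    "\<And>k. k < nat \<lfloor>1 / p\<rfloor> \<Longrightarrow> (\<Sum>m\<in>S. of_int (m - n0) ^ k * b m) = 0"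
proof -
  from assms(3) obtain n0 r0 where r0: "r0 \<ge> 1" and supp: "{n. b n \<noteq> 0} \<subseteq> ball_Z n0 r0"
    and size: "(SUP n. norm (b n)) \<le> real (card (ball_Z n0 r0)) powr (- 1 / p)"
    and mom: "\<And>k :: nat. real k \<le> 1 / p - 1 \<Longrightarrow> (\<Sum>\<^sub>\<infinity>n. of_int n ^ k * b n) = 0"
    unfolding hardy_atom_def by blast
  define r where "r = \<lceil>r0\<rceil>"
  have r: "r \<ge> 1" "r0 \<le> of_int r" using r0 by (auto simp: r_def)
  define S where "S = ball_Z n0 r0"
  have S_eq: "S = {n0 - (r - 1)..n0 + (r - 1)}"
  proof -
    have "real_of_int \<bar>n - n0\<bar> < r0 \<longleftrightarrow> \<bar>n - n0\<bar> < r" for n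
      unfolding r_def by (simp only: less_ceiling_iff)
    then have "S = {n. \<bar>n - n0\<bar> < r}" unfolding S_def ball_Z_def by (simp only:)
    also have "\<dots> = {n0 - (r - 1)..n0 + (r - 1)}" by auto
    finally show ?thesis .
  qed
  have fin: "finite S" by (simp add: S_eq)
  have card: "real (card S) = 2 * of_int r - 1" using r by (simp add: S_eq)
  have bS: "{m. b m \<noteq> 0} \<subseteq> S" using supp by (simp add: S_def)
  have momS: "(\<Sum>m\<in>S. of_int m ^ k * b m) = 0" if "real k \<le> 1 / p - 1" for k
  proof -
    have "(\<Sum>\<^sub>\<infinity>n. of_int n ^ k * b n) = (\<Sum>\<^sub>\<infinity>n\<in>S. of_int n ^ k * b n)"
      by (rule infsum_cong_neutral) (use bS in auto)
    then show ?thesis using mom[OF that] fin by simp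
  qed
  show thesis
  proof (rule that[of "of_int r" S n0])
    show "norm (b m) \<le> of_int r powr (- 1 / p)" for m
    proof -
      have "range (\<lambda>n. norm (b n)) \<subseteq> insert 0 ((\<lambda>n. norm (b n)) ` S)" using bS by auto
      then have "bdd_above (range (\<lambda>n. norm (b n)))"
        using fin by (intro bdd_above_finite) (auto elim: finite_subset)
      then have "norm (b m) \<le> (SUP n. norm (b n))" by (rule cSUP_upper[rotated]) simp
      also have "\<dots> \<le> real (card S) powr (- 1 / p)" using size by (simp add: S_def)
      also have "\<dots> \<le> of_int r powr (- 1 / p)" using r p card by (intro powr_mono2') auto
      finally show ?thesis .
    qed
    show "(\<Sum>m\<in>S. of_int (m - n0) ^ k * b m) = 0" if k: "k < nat \<lfloor>1 / p\<rfloor>" for k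
    proof (rule translated_moment_eq_0, rule momS)
      fix i assume "i \<le> k"
      then have "int i + 1 \<le> \<lfloor>1 / p\<rfloor>" using k by linarith
      then have "real_of_int (int i + 1) \<le> 1 / p" by (simp only: le_floor_iff)
      then show "real i \<le> 1 / p - 1" by simp
    qed
    show "real_of_int \<bar>m - n0\<bar> \<le> of_int r" if "m \<in> S" for m
      using that r by (simp only: of_int_le_iff) (auto simp: S_eq)
  qed (use r fin bS card in auto)
qed

lemma sum_norm_le_of_card:
  fixes b :: "int \<Rightarrow> complex"
  assumes "R \<ge> 1" "real (card S) \<le> 2 * R" "\<And>m. norm (b m) \<le> R powr a"
  shows "(\<Sum>m\<in>S. norm (b m) ^ k) \<le> 2 * R powr (1 + real k * a)"
proof -
  have "(\<Sum>m\<in>S. norm (b m) ^ k) \<le> (\<Sum>m\<in>S. (R powr a) ^ k)"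
    by (intro sum_mono power_mono assms) auto
  also have "\<dots> = real (card S) * (R powr a) ^ k" by simp
  also have "\<dots> \<le> 2 * R * (R powr a) ^ k" using assms by (intro mult_right_mono) auto
  also have "(R powr a) ^ k = R powr (real k * a)"
    using assms(1) by (simp add: powr_powr mult.commute flip: powr_realpow)
  finally show ?thesis using assms(1) by (simp add: powr_add)
qed

lemma atom_mass_le:
  fixes b :: "int \<Rightarrow> complex"
  assumes R: "R \<ge> 1" "real (card S) \<le> 2 * R" "\<And>m. norm (b m) \<le> R powr (- 1 / p)"
  shows "(\<Sum>m\<in>S. norm (b m)) * R ^ K \<le> 2 * R powr (real (K + 1) - 1 / p)"
proof -
  have "(\<Sum>m\<in>S. norm (b m) ^ 1) * R ^ K \<le> 2 * R powr (1 + real 1 * (- 1 / p)) * R ^ K"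
    using R(1) by (intro mult_right_mono sum_norm_le_of_card[OF R]) auto
  also have "\<dots> = 2 * (R powr (1 + real 1 * (- 1 / p)) * R powr real K)"
    using R(1) by (simp add: powr_realpow)
  also have "R powr (1 + real 1 * (- 1 / p)) * R powr real K = R powr (real (K + 1) - 1 / p)"
    by (simp flip: powr_add add: algebra_simps)
  finally show ?thesis by simp
qed

lemma hardy_atom_l1:
  assumes p: "0 < p" "p \<le> 1" and b: "hardy_atom p b"
  obtains S where "finite S" "{m. b m \<noteq> 0} \<subseteq> S" "(\<Sum>m\<in>S. norm (b m)) \<le> 2"
proof (rule hardy_atomE[OF assms])
  fix n0 :: int and R :: real and S
  assume R: "R \<ge> 1" and S: "finite S" "{m. b m \<noteq> 0} \<subseteq> S"
    and card: "real (card S) \<le> 2 * R" and size: "\<And>m. norm (b m) \<le> R powr (- 1 / p)"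
  have "(\<Sum>m\<in>S. norm (b m) ^ 1) \<le> 2 * R powr (1 + real 1 * (- 1 / p))"
    by (rule sum_norm_le_of_card[OF R card size])
  also have "\<dots> \<le> 2 * R powr 0" using p R by (intro mult_left_mono powr_mono) auto
  finally show thesis using that[OF S] R by simp
qed

text \<open>Near the support the uniform \<open>\<ell>\<^sup>1\<close> bound of the kernel preserves the size \<open>R powr (- 1 / p)\<close> of the
  atom up to a constant; far away the vanishing moments give the decay.\<close>

theorem heat_maximal_atom_bound:
  assumes p: "0 < p" "p \<le> 1"
  obtains C where "C > 0"
    "\<And>b. hardy_atom p b \<Longrightarrow> (\<integral>\<^sup>+n. enn_powr (heat_maximal b n) p \<partial>count_space UNIV) \<le> ennreal C"
proof -
  define K where "K = nat \<lfloor>1 / p\<rfloor>"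
  have K: "p * real (K + 1) > 1" unfolding K_def by (rule moment_count_gt[OF p(1)])
  obtain A1 where A1: "A1 > 0"
    "\<And>t S b n0 n R. t \<ge> 0 \<Longrightarrow> finite S \<Longrightarrow> {m. b m \<noteq> 0} \<subseteq> S \<Longrightarrow> R \<ge> 1 \<Longrightarrow>
       (\<And>m. m \<in> S \<Longrightarrow> real_of_int \<bar>m - n0\<bar> \<le> R) \<Longrightarrow>
       (\<And>k. k < K \<Longrightarrow> (\<Sum>m\<in>S. of_int (m - n0) ^ k * b m) = 0) \<Longrightarrow>
       2 * R \<le> real_of_int \<bar>n - n0\<bar> \<Longrightarrow>
       norm (heat_op t b n) \<le> A1 * ((\<Sum>m\<in>S. norm (b m)) * R ^ K / real_of_int \<bar>n - n0\<bar> ^ (K + 1))"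
    by (rule heat_op_far_bound[of K]) blast
  obtain A2 where A2: "A2 > 0"
    "\<And>t n F. t \<ge> 0 \<Longrightarrow> finite F \<Longrightarrow> (\<Sum>m\<in>F. \<bar>heat_kernel (n - m) t\<bar>) \<le> A2"
    by (rule heat_kernel_l1_bounded) blast
  define A where "A = 2 * A1 + 5 * A2\<^sup>2"
  have A: "A \<ge> 0" using A1 by (simp add: A_def)
  obtain C where C: "C > 0" "\<And>F n0 R. R \<ge> 1 \<Longrightarrow>
     (\<Sum>n\<in>{n. real_of_int \<bar>n - n0\<bar> < 2 * R}. (F n)\<^sup>2) \<le> ennreal (A * R powr (1 - 2 / p)) \<Longrightarrow>
     (\<And>n. 2 * R \<le> real_of_int \<bar>n - n0\<bar> \<Longrightarrow>
        F n \<le> ennreal (A * R powr (real (K + 1) - 1 / p) / real_of_int \<bar>n - n0\<bar> ^ (K + 1))) \<Longrightarrow>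
     (\<integral>\<^sup>+n. enn_powr (F n) p \<partial>count_space UNIV) \<le> ennreal C"
    by (rule lp_bound_of_local_far[OF p K A]) blast
  have "(\<integral>\<^sup>+n. enn_powr (heat_maximal b n) p \<partial>count_space UNIV) \<le> ennreal C" if b: "hardy_atom p b" for b
  proof (rule hardy_atomE[OF p b])
    fix n0 :: int and R :: real and S
    assume R: "R \<ge> 1" and S: "finite S" "{m. b m \<noteq> 0} \<subseteq> S"
      and supp: "\<And>m. m \<in> S \<Longrightarrow> real_of_int \<bar>m - n0\<bar> \<le> R"
      and card: "real (card S) \<le> 2 * R" and size: "\<And>m. norm (b m) \<le> R powr (- 1 / p)"
      and mom: "\<And>k. k < nat \<lfloor>1 / p\<rfloor> \<Longrightarrow> (\<Sum>m\<in>S. of_int (m - n0) ^ k * b m) = 0"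
    show ?thesis
    proof (rule C(2)[OF R])
      have le: "heat_maximal b n \<le> ennreal (A2 * R powr (- 1 / p))" for n
        unfolding heat_maximal_def
      proof (rule SUP_least)
        fix t :: real assume t: "t \<in> {0<..}"
        have "norm (heat_op t b n) \<le> (\<Sum>m\<in>S. \<bar>heat_kernel (n - m) t\<bar> * R powr (- 1 / p))"
          unfolding heat_op_finite_support[OF S]
          by (rule sum_norm_le, unfold norm_mult norm_of_real, rule mult_left_mono[OF size]) simp
        also have "\<dots> \<le> A2 * R powr (- 1 / p)"
          using t unfolding sum_distrib_right[symmetric] by (intro mult_right_mono A2 S) auto
        finally show "ennreal (norm (heat_op t b n)) \<le> ennreal (A2 * R powr (- 1 / p))"
          by (rule ennreal_leI)
      qed
      define G where "G = {n. real_of_int \<bar>n - n0\<bar> < 2 * R}"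
      have cardG: "real (card G) \<le> 5 * R" unfolding G_def by (rule card_int_ball_le[OF R])
      have "(\<Sum>n\<in>G. (heat_maximal b n)\<^sup>2) \<le> (\<Sum>n\<in>G. (ennreal (A2 * R powr (- 1 / p)))\<^sup>2)"
        by (intro sum_mono power_mono le) auto
      also have "\<dots> = ennreal (real (card G) * (A2 * R powr (- 1 / p))\<^sup>2)"
      proof -
        have "(ennreal (A2 * R powr (- 1 / p)))\<^sup>2 = ennreal ((A2 * R powr (- 1 / p))\<^sup>2)"
          using A2 by (intro ennreal_power) auto
        then show ?thesis by (simp only: sum_constant ennreal_of_nat_eq_real_of_nat ennreal_mult' of_nat_0_le_iff)
      qed
      also have "\<dots> \<le> ennreal (5 * R * (A2 * R powr (- 1 / p))\<^sup>2)"
        using cardG by (intro ennreal_leI mult_right_mono) auto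
      also have "5 * R * (A2 * R powr (- 1 / p))\<^sup>2 = 5 * A2\<^sup>2 * R powr (1 - 2 / p)"
      proof -
        have "(R powr (- 1 / p))\<^sup>2 = R powr (- 2 / p)"
          using R by (simp add: power2_eq_square flip: powr_add)
        moreover have "R * R powr (- 2 / p) = R powr (1 - 2 / p)"
          using R by (simp add: powr_diff powr_minus divide_inverse)
        ultimately show ?thesis by (simp add: power_mult_distrib mult_ac)
      qed
      also have "ennreal \<dots> \<le> ennreal (A * R powr (1 - 2 / p))"
        using A1 by (intro ennreal_leI mult_right_mono) (auto simp: A_def)
      finally show "(\<Sum>n\<in>{n. real_of_int \<bar>n - n0\<bar> < 2 * R}. (heat_maximal b n)\<^sup>2) \<le> ennreal (A * R powr (1 - 2 / p))"
        unfolding G_def .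
    next
      fix n assume far: "2 * R \<le> real_of_int \<bar>n - n0\<bar>"
      show "heat_maximal b n \<le> ennreal (A * R powr (real (K + 1) - 1 / p) / real_of_int \<bar>n - n0\<bar> ^ (K + 1))"
        unfolding heat_maximal_def
      proof (intro SUP_least ennreal_leI)
        fix t :: real assume t: "t \<in> {0<..}"
        have "norm (heat_op t b n) \<le> A1 * ((\<Sum>m\<in>S. norm (b m)) * R ^ K / real_of_int \<bar>n - n0\<bar> ^ (K + 1))"
          using t by (intro A1 S R supp mom[folded K_def] far) auto
        also have "\<dots> \<le> A1 * (2 * R powr (real (K + 1) - 1 / p) / real_of_int \<bar>n - n0\<bar> ^ (K + 1))"
          using A1 by (intro mult_left_mono divide_right_mono atom_mass_le[OF R card size]) auto
        also have "\<dots> \<le> A * R powr (real (K + 1) - 1 / p) / real_of_int \<bar>n - n0\<bar> ^ (K + 1)"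
        proof -
          have "2 * A1 * (R powr (real (K + 1) - 1 / p) / real_of_int \<bar>n - n0\<bar> ^ (K + 1))
              \<le> A * (R powr (real (K + 1) - 1 / p) / real_of_int \<bar>n - n0\<bar> ^ (K + 1))"
            by (intro mult_right_mono) (auto simp: A_def)
          then show ?thesis by (simp only: times_divide_eq_right mult_ac)
        qed
        finally show "norm (heat_op t b n) \<le> A * R powr (real (K + 1) - 1 / p) / real_of_int \<bar>n - n0\<bar> ^ (K + 1)" .
      qed
    qed
  qed
  with C(1) show thesis using that by blast
qed

theorem heat_square_atom_bound:
  assumes p: "0 < p" "p \<le> 1"
  obtains C where "C > 0"
    "\<And>b. hardy_atom p b \<Longrightarrow> (\<integral>\<^sup>+n. enn_powr (heat_square b n) p \<partial>count_space UNIV) \<le> ennreal C"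
proof -
  define K where "K = nat \<lfloor>1 / p\<rfloor>"
  have K: "p * real (K + 1) > 1" unfolding K_def by (rule moment_count_gt[OF p(1)])
  obtain A1 where A1: "A1 > 0"
    "\<And>S b n0 n R. finite S \<Longrightarrow> {m. b m \<noteq> 0} \<subseteq> S \<Longrightarrow> R \<ge> 1 \<Longrightarrow>
       (\<And>m. m \<in> S \<Longrightarrow> real_of_int \<bar>m - n0\<bar> \<le> R) \<Longrightarrow>
       (\<And>k. k < K \<Longrightarrow> (\<Sum>m\<in>S. of_int (m - n0) ^ k * b m) = 0) \<Longrightarrow>
       2 * R \<le> real_of_int \<bar>n - n0\<bar> \<Longrightarrow>
       (\<integral>\<^sup>+t\<in>{0<..}. ennreal (t * (norm (heat_contour S b 0 1 t n))\<^sup>2) \<partial>lborel)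
         \<le> ennreal ((A1 * ((\<Sum>m\<in>S. norm (b m)) * R ^ K / real_of_int \<bar>n - n0\<bar> ^ (K + 1)))\<^sup>2)"
    by (rule heat_contour_square_far_bound[of K]) blast
  define A where "A = 2 * A1 + 1"
  have A: "A \<ge> 0" using A1 by (simp add: A_def)
  obtain C where C: "C > 0" "\<And>F n0 R. R \<ge> 1 \<Longrightarrow>
     (\<Sum>n\<in>{n. real_of_int \<bar>n - n0\<bar> < 2 * R}. (F n)\<^sup>2) \<le> ennreal (A * R powr (1 - 2 / p)) \<Longrightarrow>
     (\<And>n. 2 * R \<le> real_of_int \<bar>n - n0\<bar> \<Longrightarrow>
        F n \<le> ennreal (A * R powr (real (K + 1) - 1 / p) / real_of_int \<bar>n - n0\<bar> ^ (K + 1))) \<Longrightarrow>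
     (\<integral>\<^sup>+n. enn_powr (F n) p \<partial>count_space UNIV) \<le> ennreal C"
    by (rule lp_bound_of_local_far[OF p K A]) blast
  have "(\<integral>\<^sup>+n. enn_powr (heat_square b n) p \<partial>count_space UNIV) \<le> ennreal C" if b: "hardy_atom p b" for b
  proof (rule hardy_atomE[OF p b])
    fix n0 :: int and R :: real and S
    assume R: "R \<ge> 1" and S: "finite S" "{m. b m \<noteq> 0} \<subseteq> S"
      and supp: "\<And>m. m \<in> S \<Longrightarrow> real_of_int \<bar>m - n0\<bar> \<le> R"
      and card: "real (card S) \<le> 2 * R" and size: "\<And>m. norm (b m) \<le> R powr (- 1 / p)"
      and mom: "\<And>k. k < nat \<lfloor>1 / p\<rfloor> \<Longrightarrow> (\<Sum>m\<in>S. of_int (m - n0) ^ k * b m) = 0"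
    show ?thesis
    proof (rule C(2)[OF R])
      have "(\<Sum>n\<in>{n. real_of_int \<bar>n - n0\<bar> < 2 * R}. (heat_square b n)\<^sup>2) \<le> ennreal ((\<Sum>m\<in>S. (norm (b m))\<^sup>2) / 4)"
        unfolding heat_square_eq[OF S] enn_powr_half_square
        by (rule heat_contour_square_l2[OF S(1) finite_int_ball])
      also have "\<dots> \<le> ennreal (A * R powr (1 - 2 / p))"
      proof (rule ennreal_leI)
        have "(\<Sum>m\<in>S. (norm (b m))\<^sup>2) \<le> 2 * R powr (1 + real 2 * (- 1 / p))"
          by (rule sum_norm_le_of_card[OF R card size])
        then have "(\<Sum>m\<in>S. (norm (b m))\<^sup>2) \<le> 2 * R powr (1 - 2 / p)" by simp
        with powr_ge_zero[of R "1 - 2 / p"]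
        have "(\<Sum>m\<in>S. (norm (b m))\<^sup>2) / 4 \<le> 1 * R powr (1 - 2 / p)" by linarith
        also have "\<dots> \<le> A * R powr (1 - 2 / p)"
          using A1 by (intro mult_right_mono) (auto simp: A_def)
        finally show "(\<Sum>m\<in>S. (norm (b m))\<^sup>2) / 4 \<le> A * R powr (1 - 2 / p)" .
      qed
      finally show "(\<Sum>n\<in>{n. real_of_int \<bar>n - n0\<bar> < 2 * R}. (heat_square b n)\<^sup>2) \<le> ennreal (A * R powr (1 - 2 / p))" .
    next
      fix n assume far: "2 * R \<le> real_of_int \<bar>n - n0\<bar>"
      define B where "B = (\<Sum>m\<in>S. norm (b m)) * R ^ K / real_of_int \<bar>n - n0\<bar> ^ (K + 1)"
      have B: "B \<ge> 0" using R by (auto simp: B_def intro!: divide_nonneg_nonneg mult_nonneg_nonneg sum_nonneg)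
      have "heat_square b n \<le> enn_powr (ennreal ((A1 * B)\<^sup>2)) (1 / 2)"
        unfolding heat_square_eq[OF S] B_def
        by (intro enn_powr_mono A1 S R supp mom[folded K_def] far) auto
      also have "\<dots> = ennreal (A1 * B)"
        using A1 B by (simp flip: ennreal_power)
      also have "\<dots> \<le> ennreal (A * R powr (real (K + 1) - 1 / p) / real_of_int \<bar>n - n0\<bar> ^ (K + 1))"
      proof (rule ennreal_leI)
        have "A1 * B \<le> A1 * (2 * R powr (real (K + 1) - 1 / p) / real_of_int \<bar>n - n0\<bar> ^ (K + 1))"
          unfolding B_def using A1 by (intro mult_left_mono divide_right_mono atom_mass_le[OF R card size]) auto
        also have "\<dots> \<le> A * R powr (real (K + 1) - 1 / p) / real_of_int \<bar>n - n0\<bar> ^ (K + 1)"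
        proof -
          have "2 * A1 * (R powr (real (K + 1) - 1 / p) / real_of_int \<bar>n - n0\<bar> ^ (K + 1))
              \<le> A * (R powr (real (K + 1) - 1 / p) / real_of_int \<bar>n - n0\<bar> ^ (K + 1))"
            by (intro mult_right_mono) (auto simp: A_def)
          then show ?thesis by (simp only: times_divide_eq_right mult_ac)
        qed
        finally show "A1 * B \<le> A * R powr (real (K + 1) - 1 / p) / real_of_int \<bar>n - n0\<bar> ^ (K + 1)" .
      qed
      finally show "heat_square b n \<le> ennreal (A * R powr (real (K + 1) - 1 / p) / real_of_int \<bar>n - n0\<bar> ^ (K + 1))" .
    qed
  qed
  with C(1) show thesis using that by blast
qed

section \<open>Superposition of atoms\<close>

lemma hardy_atom_bounded_by_2:
  assumes p: "0 < p" "p \<le> 1" and b: "hardy_atom p b"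
  shows "norm (b m) \<le> 2"
proof (rule hardy_atom_l1[OF assms])
  fix S assume S: "finite S" "{m. b m \<noteq> 0} \<subseteq> S" "(\<Sum>m\<in>S. norm (b m)) \<le> 2"
  show ?thesis
  proof (cases "m \<in> S")
    case True
    then have "norm (b m) \<le> (\<Sum>m\<in>S. norm (b m))" using S by (intro member_le_sum) auto
    with S show ?thesis by simp
  next
    case False
    then have "b m = 0" using S by auto
    then show ?thesis by simp
  qed
qed

lemma atomic_data_summable:
  assumes p: "0 < p" "p \<le> 1" and "atomic_data p l b"
  shows "summable l"
  by (rule suminf_powr_le(1)[OF p]) (use assms(3) in \<open>auto simp: atomic_data_def\<close>)

text \<open>For \<open>p = 1\<close> the decomposition converges in the \<open>\<ell>\<^sup>1\<close> norm, which dominates every single coordinate.\<close>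

lemma atomic_rep_imp_sums:
  assumes rep: "atomic_rep p f l b" and p: "p \<le> 1"
  shows "(\<lambda>j. complex_of_real (l j) * b j n) sums f n"
proof (cases "p < 1")
  case True
  then show ?thesis using rep by (simp add: atomic_rep_def)
next
  case False
  define e where "e = (\<lambda>N. f n - (\<Sum>j<N. complex_of_real (l j) * b j n))"
  let ?L = "\<lambda>N. lp_norm 1 (\<lambda>n. ennreal (norm (f n - (\<Sum>j<N. complex_of_real (l j) * b j n))))"
  have lim: "?L \<longlonglongrightarrow> 0" using rep False by (simp add: atomic_rep_def)
  have le: "ennreal (norm (e N)) \<le> ?L N" for N
    unfolding lp_norm_def by (simp add: e_def) (rule nn_integral_ge_point, simp)
  have "(\<lambda>N. ennreal (norm (e N))) \<longlonglongrightarrow> 0"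
    by (rule tendsto_sandwich[OF _ _ tendsto_const lim]) (auto simp: le)
  then have "(\<lambda>N. norm (e N)) \<longlonglongrightarrow> 0"
    using tendsto_ennrealD[of "\<lambda>N. norm (e N)" 0 sequentially] by simp
  then have "e \<longlonglongrightarrow> 0" by (rule tendsto_norm_zero_cancel)
  then have "(\<lambda>N. f n - e N) \<longlonglongrightarrow> f n - 0" by (intro tendsto_diff tendsto_const)
  then show ?thesis by (simp add: e_def sums_def)
qed

text \<open>The atoms are bounded in \<open>\<ell>\<^sup>1\<close> and the coefficients are summable since \<open>p \<le> 1\<close>, so the
  double series over positions and atoms converges absolutely.\<close>

lemma heat_op_atomic_sums:
  assumes p: "0 < p" "p \<le> 1" and data: "atomic_data p l b"
    and f: "\<And>n. (\<lambda>j. complex_of_real (l j) * b j n) sums f n" and t: "t \<ge> 0"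
  shows "(\<lambda>j. complex_of_real (l j) * heat_op t (b j) n) sums heat_op t f n"
proof -
  have atom: "hardy_atom p (b j)" and l: "l j \<ge> 0" for j using data by (auto simp: atomic_data_def)
  have sum_l: "summable l" by (rule atomic_data_summable[OF p data])
  define T where "T = (\<lambda>(j, m). complex_of_real (heat_kernel (n - m) t) * (complex_of_real (l j) * b j m))"
  have norm_T: "norm (T (j, m)) \<le> l j * norm (b j m)" for j m
    using mult_right_mono[OF heat_kernel_le_1[OF t, of "n - m"], of "l j * norm (b j m)"] l[of j]
    by (simp add: T_def norm_mult)
  have row: "(\<lambda>m. norm (T (j, m))) summable_on UNIV \<and> infsum (\<lambda>m. norm (T (j, m))) UNIV \<le> 2 * l j
      \<and> infsum (\<lambda>m. T (j, m)) UNIV = complex_of_real (l j) * heat_op t (b j) n" for j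
  proof (rule hardy_atom_l1[OF p atom[of j]])
    fix S assume S: "finite S" "{m. b j m \<noteq> 0} \<subseteq> S" "(\<Sum>m\<in>S. norm (b j m)) \<le> 2"
    have zero: "T (j, m) = 0" if "m \<notin> S" for m using S(2) that by (auto simp: T_def)
    have 1: "(\<lambda>m. norm (T (j, m))) summable_on UNIV"
      using summable_on_finite[OF S(1), of "\<lambda>m. norm (T (j, m))"]
      by (subst summable_on_cong_neutral[where T = S and g = "\<lambda>m. norm (T (j, m))"]) (auto simp: zero)
    have "infsum (\<lambda>m. norm (T (j, m))) UNIV = infsum (\<lambda>m. norm (T (j, m))) S"
      by (rule infsum_cong_neutral) (auto simp: zero)
    also have "\<dots> = (\<Sum>m\<in>S. norm (T (j, m)))" using S(1) by simp
    also have "\<dots> \<le> (\<Sum>m\<in>S. l j * norm (b j m))" by (intro sum_mono norm_T)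
    also have "\<dots> = l j * (\<Sum>m\<in>S. norm (b j m))" by (simp add: sum_distrib_left)
    also have "\<dots> \<le> l j * 2" by (intro mult_left_mono S l)
    finally have 2: "infsum (\<lambda>m. norm (T (j, m))) UNIV \<le> 2 * l j" by simp
    have "infsum (\<lambda>m. T (j, m)) UNIV = infsum (\<lambda>m. T (j, m)) S"
      by (rule infsum_cong_neutral) (auto simp: zero)
    also have "\<dots> = complex_of_real (l j) * heat_op t (b j) n"
      unfolding heat_op_finite_support[OF S(1,2)] using S(1)
      by (simp add: T_def sum_distrib_left mult_ac)
    finally show ?thesis using 1 2 by blast
  qed
  have "(\<lambda>j. norm (infsum (\<lambda>m. norm (T (j, m))) UNIV)) summable_on UNIV"
  proof (rule norm_summable_imp_summable_on)
    have "infsum (\<lambda>m. norm (T (j, m))) UNIV \<ge> 0" for j by (intro infsum_nonneg) auto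
    then show "summable (\<lambda>j. norm (norm (infsum (\<lambda>m. norm (T (j, m))) UNIV)))"
      using row by (intro summable_comparison_test'[OF summable_mult[OF sum_l, of 2], of 0]) auto
  qed
  then have "(\<lambda>x. norm (T x)) summable_on UNIV \<times> UNIV"
    using row by (subst Infinite_Sum.abs_summable_on_Sigma_iff) auto
  then have T_sum: "(\<lambda>(j, m). T (j, m)) summable_on UNIV \<times> UNIV"
    using Infinite_Sum.abs_summable_summable by (simp add: case_prod_beta)
  have col: "infsum (\<lambda>j. T (j, m)) UNIV = complex_of_real (heat_kernel (n - m) t) * f m" for m
  proof -
    have "summable (\<lambda>j. norm (complex_of_real (l j) * b j m))"
    proof (rule summable_comparison_test'[OF summable_mult[OF sum_l, of 2], of 0])
      show "norm (norm (complex_of_real (l j) * b j m)) \<le> 2 * l j" for j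
        using mult_left_mono[OF hardy_atom_bounded_by_2[OF p atom[of j], of m] l[of j]] l[of j]
        by (simp add: norm_mult mult.commute)
    qed
    from norm_summable_imp_has_sum[OF this f]
    have "((\<lambda>j. complex_of_real (l j) * b j m) has_sum f m) UNIV" .
    from has_sum_cmult_right[OF this, of "complex_of_real (heat_kernel (n - m) t)"]
    show ?thesis by (simp add: T_def infsumI)
  qed
  have "heat_op t f n = infsum (\<lambda>m. infsum (\<lambda>j. T (j, m)) UNIV) UNIV"
    unfolding heat_op_def col ..
  also have "\<dots> = infsum (\<lambda>j. infsum (\<lambda>m. T (j, m)) UNIV) UNIV"
    by (rule infsum_swap_banach[OF T_sum, symmetric])
  also have "\<dots> = infsum (\<lambda>j. complex_of_real (l j) * heat_op t (b j) n) UNIV"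
    using row by simp
  finally have eq: "heat_op t f n = infsum (\<lambda>j. complex_of_real (l j) * heat_op t (b j) n) UNIV" .
  have "(\<lambda>j. infsum (\<lambda>m. T (j, m)) UNIV) summable_on UNIV"
    using summable_on_Sigma_banach[OF T_sum] by simp
  then have "(\<lambda>j. complex_of_real (l j) * heat_op t (b j) n) summable_on UNIV"
    using row by simp
  from has_sum_infsum[OF this] show ?thesis unfolding eq by (rule has_sum_imp_sums)
qed

lemma norm_vector_derivative_heat_op_atom_le:
  assumes p: "0 < p" "p \<le> 1" and b: "hardy_atom p b" and t: "t \<ge> 0"
  shows "norm (vector_derivative (\<lambda>s. heat_op s b n) (at t)) \<le> 8"
proof (rule hardy_atom_l1[OF p b])
  fix S assume S: "finite S" "{m. b m \<noteq> 0} \<subseteq> S" "(\<Sum>m\<in>S. norm (b m)) \<le> 2"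
  have "norm (vector_derivative (\<lambda>s. heat_op s b n) (at t)) = norm (heat_contour S b 0 1 t n)"
    by (simp only: heat_op_vector_derivative[OF S(1,2), of n t 0])
  also have "\<dots> \<le> 4 ^ 1 * (\<Sum>m\<in>S. norm (b m))" by (rule heat_contour_bound[OF t])
  also have "\<dots> \<le> 8" using S(3) by simp
  finally show ?thesis .
qed

text \<open>The time derivatives of the flows of all atoms have a common bound, so the series may be
  differentiated term by term on \<open>t > 0\<close>.\<close>

lemma vector_derivative_heat_op_atomic_sums:
  assumes p: "0 < p" "p \<le> 1" and data: "atomic_data p l b"
    and f: "\<And>n. (\<lambda>j. complex_of_real (l j) * b j n) sums f n" and t: "t > 0"
  shows "(\<lambda>j. complex_of_real (l j) * vector_derivative (\<lambda>s. heat_op s (b j) n) (at t))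
    sums vector_derivative (\<lambda>s. heat_op s f n) (at t)"
proof -
  have atom: "hardy_atom p (b j)" and l: "l j \<ge> 0" for j using data by (auto simp: atomic_data_def)
  define d where "d = (\<lambda>j t. complex_of_real (l j) * vector_derivative (\<lambda>s. heat_op s (b j) n) (at t))"
  have deriv: "((\<lambda>s. complex_of_real (l j) * heat_op s (b j) n) has_vector_derivative d j s) (at s)" for j s
  proof (rule hardy_atom_l1[OF p atom[of j]])
    fix S assume S: "finite S" "{m. b j m \<noteq> 0} \<subseteq> S"
    show ?thesis
      unfolding d_def heat_op_vector_derivative[OF S, of n s 0]
      by (rule has_vector_derivative_mult_right) (rule heat_op_has_vector_derivative[OF S])
  qed
  have norm_d: "norm (d j s) \<le> 8 * l j" if "s \<ge> 0" for j s
    using mult_left_mono[OF norm_vector_derivative_heat_op_atom_le[OF p atom[of j] that, of n] l[of j]] l[of j]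
    by (simp add: d_def norm_mult mult.commute)
  have sum_l: "summable (\<lambda>j. 8 * l j)" by (intro summable_mult atomic_data_summable[OF p data])
  have unif: "uniform_limit {0<..} (\<lambda>N s. \<Sum>j<N. d j s) (\<lambda>s. \<Sum>j. d j s) sequentially"
    by (rule Weierstrass_m_test[OF _ sum_l]) (auto intro: norm_d)
  have "\<exists>g. \<forall>s\<in>{0<..}. (\<lambda>j. complex_of_real (l j) * heat_op s (b j) n) sums g s \<and>
      (g has_derivative (\<lambda>h. h *\<^sub>R (\<Sum>j. d j s))) (at s within {0<..})"
  proof (rule has_derivative_series)
    show "((\<lambda>s. complex_of_real (l j) * heat_op s (b j) n) has_derivative (\<lambda>h. h *\<^sub>R d j s)) (at s within {0<..})" for j s
      using deriv[of j s] unfolding has_vector_derivative_def by (rule has_derivative_at_withinI)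
    show "\<forall>\<^sub>F N in sequentially. \<forall>s\<in>{0<..}. \<forall>h. norm ((\<Sum>j<N. h *\<^sub>R d j s) - h *\<^sub>R (\<Sum>j. d j s)) \<le> e * norm h"
      if "e > 0" for e
      using uniform_limitD[OF unif that]
    proof eventually_elim
      case (elim N)
      show ?case
      proof (intro ballI allI)
        fix s h :: real assume "s \<in> {0<..}"
        then have "norm ((\<Sum>j<N. d j s) - (\<Sum>j. d j s)) \<le> e" using elim by (auto simp: dist_norm less_imp_le)
        then have "norm h * norm ((\<Sum>j<N. d j s) - (\<Sum>j. d j s)) \<le> norm h * e" by (intro mult_left_mono) auto
        then show "norm ((\<Sum>j<N. h *\<^sub>R d j s) - h *\<^sub>R (\<Sum>j. d j s)) \<le> e * norm h"
          by (simp add: scaleR_sum_right[symmetric] scaleR_diff_right[symmetric] mult.commute)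
      qed
    qed
    show "(\<lambda>j. complex_of_real (l j) * heat_op t (b j) n) sums heat_op t f n"
      using t by (intro heat_op_atomic_sums[OF p data f]) auto
  qed (use t in auto)
  then obtain g where g: "\<And>s. s > 0 \<Longrightarrow> (\<lambda>j. complex_of_real (l j) * heat_op s (b j) n) sums g s"
    and g': "(g has_derivative (\<lambda>h. h *\<^sub>R (\<Sum>j. d j t))) (at t within {0<..})"
    using t by auto
  have g_eq: "g s = heat_op s f n" if "s > 0" for s
    using sums_unique2[OF g[OF that] heat_op_atomic_sums[OF p data f, of s n]] that by simp
  have "(g has_vector_derivative (\<Sum>j. d j t)) (at t)"
    using g' t at_within_open[of t "{0<..}"] by (simp add: has_vector_derivative_def)
  then have "((\<lambda>s. heat_op s f n) has_vector_derivative (\<Sum>j. d j t)) (at t)"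
    by (rule has_vector_derivative_transform_within_open[of _ _ _ "{0<..}"]) (use t g_eq in auto)
  then have "vector_derivative (\<lambda>s. heat_op s f n) (at t) = (\<Sum>j. d j t)" by (rule vector_derivative_at)
  moreover have "summable (\<lambda>j. d j t)"
    by (rule summable_comparison_test'[OF sum_l, of 0]) (use t norm_d in auto)
  ultimately have "(\<lambda>j. d j t) sums vector_derivative (\<lambda>s. heat_op s f n) (at t)"
    by (simp only: sums_iff)
  then show ?thesis by (simp only: d_def)
qed

lemma heat_maximal_atomic_le:
  assumes p: "0 < p" "p \<le> 1" and data: "atomic_data p l b"
    and f: "\<And>n. (\<lambda>j. complex_of_real (l j) * b j n) sums f n"
  shows "heat_maximal f n \<le> (\<Sum>j. ennreal (l j) * heat_maximal (b j) n)"
  unfolding heat_maximal_def[of f]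
proof (rule SUP_least)
  fix t :: real assume t: "t \<in> {0<..}"
  have l: "l j \<ge> 0" for j using data by (auto simp: atomic_data_def)
  have "ennreal (norm (heat_op t f n)) \<le> (\<Sum>j. ennreal (norm (complex_of_real (l j) * heat_op t (b j) n)))"
    using t by (intro ennreal_norm_sums_le heat_op_atomic_sums[OF p data f]) auto
  also have "\<dots> \<le> (\<Sum>j. ennreal (l j) * heat_maximal (b j) n)"
  proof (intro suminf_le)
    fix j
    have "ennreal (norm (heat_op t (b j) n)) \<le> heat_maximal (b j) n"
      unfolding heat_maximal_def using t by (rule SUP_upper)
    then show "ennreal (norm (complex_of_real (l j) * heat_op t (b j) n)) \<le> ennreal (l j) * heat_maximal (b j) n"
      using l[of j] by (simp add: norm_mult ennreal_mult' mult_left_mono)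
  qed auto
  finally show "ennreal (norm (heat_op t f n)) \<le> (\<Sum>j. ennreal (l j) * heat_maximal (b j) n)" .
qed

lemma heat_square_atomic_le:
  assumes p: "0 < p" "p \<le> 1" and data: "atomic_data p l b"
    and f: "\<And>n. (\<lambda>j. complex_of_real (l j) * b j n) sums f n"
  shows "heat_square f n \<le> (\<Sum>j. ennreal (l j) * heat_square (b j) n)"
proof -
  have atom: "hardy_atom p (b j)" and l: "l j \<ge> 0" for j using data by (auto simp: atomic_data_def)
  define D where "D = (\<lambda>f t. vector_derivative (\<lambda>s. heat_op s f n) (at t))"
  \<comment> \<open>The square function is the norm of \<open>w f\<close> in \<open>L\<^sup>2\<close>, so Minkowski's inequality applies.\<close>
  define w where "w = (\<lambda>f t. ennreal (sqrt t * norm (D f t)) * indicator {0<..} t)"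
  have square: "heat_square f n = enn_powr (\<integral>\<^sup>+t. (w f t)\<^sup>2 \<partial>lborel) (1 / 2)" for f
  proof -
    have "ennreal ((norm (t *\<^sub>R D f t))\<^sup>2 / t) * indicator {0<..} t = (w f t)\<^sup>2" for t
    proof (cases "t > 0")
      case True
      then have "(norm (t *\<^sub>R D f t))\<^sup>2 / t = (sqrt t * norm (D f t))\<^sup>2"
        by (simp add: power_mult_distrib) (simp add: power2_eq_square)
      also have "ennreal \<dots> = (ennreal (sqrt t * norm (D f t)))\<^sup>2"
        using True by (intro ennreal_power[symmetric]) auto
      finally show ?thesis using True by (simp add: w_def)
    qed (simp add: w_def)
    then show ?thesis unfolding heat_square_def D_def by simp
  qed
  have meas [measurable]: "w (b j) \<in> borel_measurable lborel" for j
  proof (rule hardy_atom_l1[OF p atom[of j]])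
    fix S assume S: "finite S" "{m. b j m \<noteq> 0} \<subseteq> S"
    have [measurable]: "(\<lambda>t. heat_contour S (b j) 0 1 t n) \<in> borel_measurable borel"
      by (intro borel_measurable_continuous_onI continuous_on_heat_contour)
    show ?thesis
      unfolding w_def D_def heat_op_vector_derivative[OF S, of n _ 0] by measurable
  qed
  have le: "w f t \<le> (\<Sum>j. ennreal (l j) * w (b j) t)" for t
  proof (cases "t > 0")
    case True
    have "ennreal (norm (D f t)) \<le> (\<Sum>j. ennreal (norm (complex_of_real (l j) * D (b j) t)))"
      unfolding D_def by (intro ennreal_norm_sums_le vector_derivative_heat_op_atomic_sums[OF p data f True])
    then have "ennreal (sqrt t) * ennreal (norm (D f t))
        \<le> ennreal (sqrt t) * (\<Sum>j. ennreal (norm (complex_of_real (l j) * D (b j) t)))"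
      by (rule mult_left_mono) simp
    also have "\<dots> = (\<Sum>j. ennreal (sqrt t) * ennreal (norm (complex_of_real (l j) * D (b j) t)))"
      by simp
    also have "\<dots> = (\<Sum>j. ennreal (l j) * w (b j) t)"
      using True l by (intro suminf_cong) (simp add: w_def norm_mult ennreal_mult' mult_ac)
    finally show ?thesis using True by (simp add: w_def ennreal_mult')
  qed (simp add: w_def)
  have "heat_square f n \<le> enn_powr (\<integral>\<^sup>+t. (\<Sum>j. ennreal (l j) * w (b j) t)\<^sup>2 \<partial>lborel) (1 / 2)"
    unfolding square[of f] by (intro enn_powr_mono nn_integral_mono power_mono le) auto
  also have "\<dots> \<le> (\<Sum>j. enn_powr (\<integral>\<^sup>+t. (ennreal (l j) * w (b j) t)\<^sup>2 \<partial>lborel) (1 / 2))"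
    by (rule nn_integral_Minkowski_suminf) measurable
  also have "\<dots> = (\<Sum>j. ennreal (l j) * heat_square (b j) n)"
  proof (rule suminf_cong)
    fix j
    have "(\<integral>\<^sup>+t. (ennreal (l j) * w (b j) t)\<^sup>2 \<partial>lborel) = ennreal ((l j)\<^sup>2) * (\<integral>\<^sup>+t. (w (b j) t)\<^sup>2 \<partial>lborel)"
      using l by (simp add: power_mult_distrib ennreal_power nn_integral_cmult)
    then show "enn_powr (\<integral>\<^sup>+t. (ennreal (l j) * w (b j) t)\<^sup>2 \<partial>lborel) (1 / 2) = ennreal (l j) * heat_square (b j) n"
      using l[of j] by (simp add: enn_powr_cmult square powr_half_sqrt)
  qed
  finally show ?thesis .
qed

text \<open>Since \<open>p \<le> 1\<close>, the function \<open>\<lambda>x. x powr p\<close> is subadditive, also for countable sums.\<close>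

lemma lp_norm_atomic_le:
  assumes p: "0 < p" "p \<le> 1" and data: "atomic_data p l b" and C: "C > 0"
    and sub: "\<And>n. F n \<le> (\<Sum>j. ennreal (l j) * Fb j n)"
    and atoms: "\<And>j. (\<integral>\<^sup>+n. enn_powr (Fb j n) p \<partial>count_space UNIV) \<le> ennreal C"
  shows "lp_norm p F \<le> ennreal (C powr (1 / p) * ((\<Sum>j. l j powr p) powr (1 / p)))"
proof -
  have l: "l j \<ge> 0" for j using data by (auto simp: atomic_data_def)
  have sum: "summable (\<lambda>j. l j powr p)" using data by (auto simp: atomic_data_def)
  have "(\<integral>\<^sup>+n. enn_powr (F n) p \<partial>count_space UNIV)
     \<le> (\<integral>\<^sup>+n. (\<Sum>j. ennreal (l j powr p) * enn_powr (Fb j n) p) \<partial>count_space UNIV)"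
  proof (rule nn_integral_mono)
    fix n
    have "enn_powr (F n) p \<le> enn_powr (\<Sum>j. ennreal (l j) * Fb j n) p"
      using p by (intro enn_powr_mono sub) auto
    also have "\<dots> \<le> (\<Sum>j. enn_powr (ennreal (l j) * Fb j n) p)" by (rule enn_powr_suminf_le[OF p])
    finally show "enn_powr (F n) p \<le> (\<Sum>j. ennreal (l j powr p) * enn_powr (Fb j n) p)"
      by (simp add: enn_powr_cmult l)
  qed
  also have "\<dots> = (\<Sum>j. ennreal (l j powr p) * (\<integral>\<^sup>+n. enn_powr (Fb j n) p \<partial>count_space UNIV))"
    by (simp add: nn_integral_suminf nn_integral_cmult)
  also have "\<dots> \<le> (\<Sum>j. ennreal (l j powr p) * ennreal C)"
    by (intro suminf_le mult_left_mono atoms) auto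
  also have "\<dots> = ennreal (\<Sum>j. l j powr p) * ennreal C"
    by (simp add: suminf_ennreal2[OF _ sum])
  also have "\<dots> = ennreal (C * (\<Sum>j. l j powr p))"
    using C suminf_nonneg[OF sum] by (simp add: ennreal_mult' mult.commute)
  finally have "lp_norm p F \<le> enn_powr (ennreal (C * (\<Sum>j. l j powr p))) (1 / p)"
    unfolding lp_norm_def using p by (intro enn_powr_mono) auto
  also have "\<dots> = ennreal ((C * (\<Sum>j. l j powr p)) powr (1 / p))"
    using C suminf_nonneg[OF sum] by (intro enn_powr_ennreal) auto
  also have "(C * (\<Sum>j. l j powr p)) powr (1 / p) = C powr (1 / p) * ((\<Sum>j. l j powr p) powr (1 / p))"
    using C suminf_nonneg[OF sum] by (simp add: powr_mult)
  finally show ?thesis .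
qed

lemma le_hardy_norm:
  assumes f: "f \<in> hardy_space p" and C: "C > 0"
    and bound: "\<And>l b. atomic_rep p f l b \<Longrightarrow> x \<le> ennreal (C * ((\<Sum>j. l j powr p) powr (1 / p)))"
  shows "x \<le> ennreal (C * hardy_norm p f)"
proof -
  \<comment> \<open>The bound holds for each element of \<open>X\<close>, and \<open>X\<close> is nonempty, so it passes to the infimum.\<close>
  define X where "X = {(\<Sum>j. l j powr p) powr (1 / p) | l b. atomic_rep p f l b}"
  have X: "x \<le> ennreal (C * y)" "y \<ge> 0" if "y \<in> X" for y using that bound by (auto simp: X_def)
  have "X \<noteq> {}" using f unfolding X_def hardy_space_def by blast
  then obtain y where "y \<in> X" by blast
  then have "x \<noteq> top" using X(1)[of y] by (auto simp: top_unique)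
  then obtain r where r: "r \<ge> 0" "x = ennreal r" by (cases x) auto
  have "r / C \<le> y" if "y \<in> X" for y
  proof -
    have "r \<le> C * y" using X[OF that] r C by (simp add: ennreal_le_iff)
    then show ?thesis using C by (simp add: field_simps)
  qed
  then have "r / C \<le> Inf X" by (intro cInf_greatest \<open>X \<noteq> {}\<close>)
  then have "r \<le> C * Inf X" using C by (simp add: field_simps)
  then show ?thesis unfolding hardy_norm_def X_def[symmetric] r by (rule ennreal_leI)
qed

theorem theorem1p2:
  fixes p :: real
  assumes "0 < p" and "p \<le> 1"
  shows "\<exists>C>0. \<forall>f\<in>hardy_space p.
           lp_norm p (heat_maximal f) \<le> ennreal (C * hardy_norm p f) \<and>
           lp_norm p (heat_square f) \<le> ennreal (C * hardy_norm p f)"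
proof -
  obtain C1 where C1: "C1 > 0"
    "\<And>b. hardy_atom p b \<Longrightarrow> (\<integral>\<^sup>+n. enn_powr (heat_maximal b n) p \<partial>count_space UNIV) \<le> ennreal C1"
    by (rule heat_maximal_atom_bound[OF assms]) blast
  obtain C2 where C2: "C2 > 0"
    "\<And>b. hardy_atom p b \<Longrightarrow> (\<integral>\<^sup>+n. enn_powr (heat_square b n) p \<partial>count_space UNIV) \<le> ennreal C2"
    by (rule heat_square_atom_bound[OF assms]) blast
  define A where "A = max C1 C2"
  have A: "A > 0" "A powr (1 / p) > 0" using C1 by (auto simp: A_def)
  have atoms: "(\<integral>\<^sup>+n. enn_powr (heat_maximal b n) p \<partial>count_space UNIV) \<le> ennreal A"
    "(\<integral>\<^sup>+n. enn_powr (heat_square b n) p \<partial>count_space UNIV) \<le> ennreal A" if "hardy_atom p b" for b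
    using C1(2)[OF that] C2(2)[OF that] by (auto simp: A_def elim!: order_trans intro!: ennreal_leI)
  have "lp_norm p (heat_maximal f) \<le> ennreal (A powr (1 / p) * hardy_norm p f) \<and>
        lp_norm p (heat_square f) \<le> ennreal (A powr (1 / p) * hardy_norm p f)"
    if f: "f \<in> hardy_space p" for f
  proof (intro conjI le_hardy_norm[OF f A(2)])
    fix l b assume rep: "atomic_rep p f l b"
    then have data: "atomic_data p l b" by (simp add: atomic_rep_def)
    then have atom: "hardy_atom p (b j)" for j by (simp add: atomic_data_def)
    note sums = atomic_rep_imp_sums[OF rep assms(2)]
    show "lp_norm p (heat_maximal f) \<le> ennreal (A powr (1 / p) * ((\<Sum>j. l j powr p) powr (1 / p)))"
      by (rule lp_norm_atomic_le[OF assms data A(1) heat_maximal_atomic_le[OF assms data sums] atoms(1)[OF atom]])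
    show "lp_norm p (heat_square f) \<le> ennreal (A powr (1 / p) * ((\<Sum>j. l j powr p) powr (1 / p)))"
      by (rule lp_norm_atomic_le[OF assms data A(1) heat_square_atomic_le[OF assms data sums] atoms(2)[OF atom]])
  qed
  with A(2) show ?thesis by blast
qed

end
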